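(* Let $D$ be an orientation of a tree with diameter at most three that is not a path. Then $D$ is converse invariant if and only if $D\cong -D$, or $D$ or $-D$ is isomorphic to the digraph $F$ with vertex set $\{u,v,x,u',y,v'\}$ (six distinct vertices) and arc set $\{(x,u),(u',u),(y,v),(v',v),(u,v)\}$.
   Context: All graphs and digraphs are finite, without loops or multiple edges/arcs. The diameter of a graph is the greatest distance between any pair of its vertices; here the tree (the underlying undirected graph of $D$) has diameter at most three and is not a path. An orientation of a graph $G$ is a digraph obtained from $G$ by replacing every edge $uv$ by exactly one of the arcs $(u,v)$, $(v,u)$. The converse $-D$ of a digraph $D$ is the digraph on the same vertex set with $(u,v)\in A(-D)$ if and only if $(v,u)\in A(D)$; $\cong$ denotes digraph isomorphism. A tournament is an orientation of a complete graph. For an oriented graph (a digraph with at most one arc between any pair of vertices) $D$ and a tournament $T$, $f_T(D)$ denotes the number of copies of $D$ in $T$, i.e. the number of (not necessarily induced) subdigraphs of $T$ isomorphic to $D$. An oriented graph $D$ is converse invariant if $f_T(D)=f_T(-D)$ for every tournament $T$. *)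

theory Defs
  imports
    "Graph_Theory.Digraph_Isomorphism"
    "Graph_Theory.Kuratowski"
    "Graph_Theory.Shortest_Path"
    "Graph_Theory.Vertex_Walk"
begin

text \<open>
  Digraphs without multiple arcs are values of type \<^typ>\<open>'a pair_pre_digraph\<close>, and a finite simple
  undirected graph is a symmetric one, i.e. one satisfying \<^const>\<open>pair_graph\<close>: the edge \<open>uv\<close> is
  represented by the two pairs \<open>(u,v)\<close> and \<open>(v,u)\<close>.
\<close>

abbreviation digraph_isomorphic ::
  "'a pair_pre_digraph \<Rightarrow> 'b pair_pre_digraph \<Rightarrow> bool" (infix \<open>\<cong>\<close> 50) where
  "D \<cong> E \<equiv> digraph_iso (with_proj D) (with_proj E)"

definition converse_digraph :: "'a pair_pre_digraph \<Rightarrow> 'a pair_pre_digraph" where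
  "converse_digraph D = \<lparr>pverts = pverts D, parcs = (parcs D)\<inverse>\<rparr>"

text \<open>
  The library predicate \<^const>\<open>tree\<close> forbids all directed cycles; in a symmetric digraph this
  includes \<open>u, v, u\<close>. Cycles of the undirected graph are the cycles of length at least three.
\<close>

definition undirected_tree :: "'a pair_pre_digraph \<Rightarrow> bool" where
  "undirected_tree G \<longleftrightarrow>
     pair_graph G \<and> connected (with_proj G) \<and>
     \<not> (\<exists>p. pre_digraph.cycle (with_proj G) p \<and> 3 \<le> length p)"

text \<open>
  \<open>wf_digraph.\<mu> G (\<lambda>_. 1) u v\<close> is the minimum number of edges of a walk from \<open>u\<close> to \<open>v\<close>.
\<close>

definition diameter :: "'a pair_pre_digraph \<Rightarrow> ereal" where
  "diameter G =
     (SUP u\<in>pverts G. SUP v\<in>pverts G. wf_digraph.\<mu> (with_proj G) (\<lambda>_. 1) u v)"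

definition path_graph :: "'a pair_pre_digraph \<Rightarrow> bool" where
  "path_graph G \<longleftrightarrow>
     (\<exists>xs. xs \<noteq> [] \<and> distinct xs \<and> pverts G = set xs \<and>
           parcs G = set (vwalk_arcs xs) \<union> (set (vwalk_arcs xs))\<inverse>)"

definition orientation :: "'a pair_pre_digraph \<Rightarrow> 'a pair_pre_digraph \<Rightarrow> bool" where
  "orientation D G \<longleftrightarrow>
     pverts D = pverts G \<and> parcs D \<subseteq> parcs G \<and>
     (\<forall>u v. (u, v) \<in> parcs G \<longrightarrow> ((u, v) \<in> parcs D \<longleftrightarrow> (v, u) \<notin> parcs D))"

definition tournament :: "'a pair_pre_digraph \<Rightarrow> bool" where
  "tournament T \<longleftrightarrow> (\<exists>n G. complete_digraph n (with_proj G) \<and> orientation T G)"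

definition num_copies :: "'b pair_pre_digraph \<Rightarrow> 'a pair_pre_digraph \<Rightarrow> nat" where
  "num_copies T D =
     card {H :: 'b pair_pre_digraph. subgraph (with_proj H) (with_proj T) \<and> H \<cong> D}"

text \<open>
  Every finite tournament is isomorphic to one with vertices in \<^typ>\<open>nat\<close>, so it suffices to
  quantify over these; see \<open>converse_invariantD\<close> below.
\<close>

definition converse_invariant :: "'a pair_pre_digraph \<Rightarrow> bool" where
  "converse_invariant D \<longleftrightarrow>
     (\<forall>T :: nat pair_pre_digraph. tournament T \<longrightarrow>
        num_copies T D = num_copies T (converse_digraph D))"

datatype F_vertex = Fu | Fv | Fx | Fu' | Fy | Fv'

definition digraph_F :: "F_vertex pair_pre_digraph" where
  "digraph_F =
     \<lparr>pverts = {Fu, Fv, Fx, Fu', Fy, Fv'},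
      parcs = {(Fx, Fu), (Fu', Fu), (Fy, Fv), (Fv', Fv), (Fu, Fv)}\<rparr>"

definition map_pair_digraph :: "('a \<Rightarrow> 'b) \<Rightarrow> 'a pair_pre_digraph \<Rightarrow> 'b pair_pre_digraph" where
  "map_pair_digraph f D = \<lparr>pverts = f ` pverts D, parcs = map_prod f f ` parcs D\<rparr>"

lemma map_pair_digraph_sel [simp]:
  "pverts (map_pair_digraph f D) = f ` pverts D"
  "parcs (map_pair_digraph f D) = map_prod f f ` parcs D"
  by (simp_all add: map_pair_digraph_def)

lemma pair_digraph_isomorphic_iff:
  fixes D :: "'a pair_pre_digraph" and E :: "'b pair_pre_digraph"
  shows "D \<cong> E \<longleftrightarrow>
    pair_wf_digraph D \<and> (\<exists>f. inj_on f (pverts D) \<and> E = map_pair_digraph f D)"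
proof
  assume "D \<cong> E"
  then obtain h where h: "pre_digraph.digraph_isomorphism (with_proj D) h"
    and E: "with_proj E = app_iso h (with_proj D)"
    unfolding digraph_iso_def by blast
  have wf: "wf_digraph (with_proj D)" and inj: "inj_on (iso_verts h) (pverts D)"
    using h by (simp_all add: pre_digraph.digraph_isomorphism_def)
  have th: "iso_tail h = fst" "iso_head h = snd"
    and vE: "pverts E = iso_verts h ` pverts D"
    and aE: "parcs E = iso_arcs h ` parcs D"
    using E by (simp_all add: with_proj_def app_iso_def)
  have "iso_arcs h a = map_prod (iso_verts h) (iso_verts h) a" if "a \<in> parcs D" for a
    using h that th by (auto simp: pre_digraph.digraph_isomorphism_def prod_eq_iff)
  hence "parcs E = map_prod (iso_verts h) (iso_verts h) ` parcs D"
    using aE by simp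
  hence "E = map_pair_digraph (iso_verts h) D"
    using vE by simp
  moreover have "pair_wf_digraph D"
    using wf by (simp add: wf_digraph_wp_iff)
  ultimately show "pair_wf_digraph D \<and> (\<exists>f. inj_on f (pverts D) \<and> E = map_pair_digraph f D)"
    using inj by blast
next
  assume "pair_wf_digraph D \<and> (\<exists>f. inj_on f (pverts D) \<and> E = map_pair_digraph f D)"
  then obtain f where wf: "pair_wf_digraph D" and inj: "inj_on f (pverts D)"
    and E: "E = map_pair_digraph f D"
    by blast
  interpret pair_wf_digraph D by (rule wf)
  let ?h = "\<lparr>iso_verts = f, iso_arcs = map_prod f f, iso_head = snd, iso_tail = fst\<rparr>"
  have "inj_on (map_prod f f) (parcs D)"
    by (rule inj_on_subset[OF map_prod_inj_on[OF inj inj]]) (auto dest: in_arcsD1 in_arcsD2)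
  hence "pre_digraph.digraph_isomorphism (with_proj D) ?h"
    using inj wf by (auto simp: pre_digraph.digraph_isomorphism_def wf_digraph_wp_iff)
  moreover have "with_proj E = app_iso ?h (with_proj D)"
    by (simp add: E with_proj_def app_iso_def)
  ultimately show "D \<cong> E"
    unfolding digraph_iso_def by blast
qed

lemma subgraph_pair_iff:
  "subgraph (with_proj H) (with_proj T) \<longleftrightarrow>
     pverts H \<subseteq> pverts T \<and> parcs H \<subseteq> parcs T \<and> pair_wf_digraph T \<and> pair_wf_digraph H"
  by (auto simp: subgraph_def compatible_def wf_digraph_wp_iff)

lemma map_pair_digraph_wf:
  "pair_wf_digraph D \<Longrightarrow> pair_wf_digraph (map_pair_digraph f D)"
  by (auto simp: pair_wf_digraph_def)

lemma map_pair_digraph_comp: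
  "map_pair_digraph f (map_pair_digraph g D) = map_pair_digraph (f \<circ> g) D"
  by (auto simp: map_pair_digraph_def image_image prod.map_comp)

lemma map_pair_digraph_inverse:
  assumes "pair_wf_digraph D" "\<And>v. v \<in> pverts D \<Longrightarrow> f v = v"
  shows "map_pair_digraph f D = D"
proof -
  have "map_prod f f a = a" if "a \<in> parcs D" for a
    using assms that by (cases a) (auto simp: pair_wf_digraph_def)
  thus ?thesis using assms(2) by (simp add: map_pair_digraph_def)
qed

lemma map_pair_digraph_isomorphic:
  assumes "pair_wf_digraph H" "inj_on h (pverts H)"
  shows "map_pair_digraph h H \<cong> D \<longleftrightarrow> H \<cong> D"
proof
  assume "map_pair_digraph h H \<cong> D"
  then obtain f where "inj_on f (h ` pverts H)" "D = map_pair_digraph f (map_pair_digraph h H)"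
    by (auto simp: pair_digraph_isomorphic_iff)
  thus "H \<cong> D"
    using assms by (auto simp: pair_digraph_isomorphic_iff map_pair_digraph_comp
        intro!: exI[of _ "f \<circ> h"] comp_inj_on)
next
  let ?g = "the_inv_into (pverts H) h"
  assume "H \<cong> D"
  then obtain f where f: "inj_on f (pverts H)" "D = map_pair_digraph f H"
    by (auto simp: pair_digraph_isomorphic_iff)
  have id: "map_pair_digraph ?g (map_pair_digraph h H) = H"
    unfolding map_pair_digraph_comp
    using assms by (intro map_pair_digraph_inverse) (auto simp: the_inv_into_f_f)
  have "inj_on (f \<circ> ?g) (h ` pverts H)"
    using assms f by (auto simp: inj_on_def the_inv_into_f_f)
  moreover have "D = map_pair_digraph (f \<circ> ?g) (map_pair_digraph h H)"
    using id f by (simp flip: map_pair_digraph_comp)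
  ultimately show "map_pair_digraph h H \<cong> D"
    using assms by (auto simp: pair_digraph_isomorphic_iff intro: map_pair_digraph_wf)
qed

lemma num_copies_map_pair_digraph:
  assumes wf: "pair_wf_digraph T" and inj: "inj_on h (pverts T)"
  shows "num_copies (map_pair_digraph h T) D = num_copies T D"
proof -
  let ?g = "the_inv_into (pverts T) h"
  let ?A = "{H. subgraph (with_proj H) (with_proj T) \<and> H \<cong> D}"
  let ?B = "{H. subgraph (with_proj H) (with_proj (map_pair_digraph h T)) \<and> H \<cong> D}"
  have gh: "map_pair_digraph ?g (map_pair_digraph h H) = H"
    if "pair_wf_digraph H" "pverts H \<subseteq> pverts T" for H
    unfolding map_pair_digraph_comp
    using that inj by (intro map_pair_digraph_inverse) (auto simp: the_inv_into_f_f)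
  have hg: "map_pair_digraph h (map_pair_digraph ?g H) = H"
    if "pair_wf_digraph H" "pverts H \<subseteq> h ` pverts T" for H
    unfolding map_pair_digraph_comp
    using that inj by (intro map_pair_digraph_inverse) (auto simp: f_the_inv_into_f)
  have "bij_betw (map_pair_digraph h) ?A ?B"
  proof (rule bij_betw_byWitness[where f' = "map_pair_digraph ?g"])
    show "\<forall>H\<in>?A. map_pair_digraph ?g (map_pair_digraph h H) = H"
      by (auto simp: subgraph_pair_iff intro!: gh)
    show "\<forall>H\<in>?B. map_pair_digraph h (map_pair_digraph ?g H) = H"
      by (auto simp: subgraph_pair_iff intro!: hg)
    show "map_pair_digraph h ` ?A \<subseteq> ?B"
    proof clarify
      fix H assume "subgraph (with_proj H) (with_proj T)" "H \<cong> D"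
      thus "subgraph (with_proj (map_pair_digraph h H)) (with_proj (map_pair_digraph h T)) \<and>
          map_pair_digraph h H \<cong> D"
        using inj by (subst map_pair_digraph_isomorphic)
          (auto simp: subgraph_pair_iff map_pair_digraph_wf intro: inj_on_subset)
    qed
    show "map_pair_digraph ?g ` ?B \<subseteq> ?A"
    proof clarify
      fix H assume H: "subgraph (with_proj H) (with_proj (map_pair_digraph h T))" "H \<cong> D"
      hence H': "pair_wf_digraph H" "pverts H \<subseteq> h ` pverts T" "parcs H \<subseteq> map_prod h h ` parcs T"
        by (auto simp: subgraph_pair_iff)
      have "map_pair_digraph ?g H \<cong> D"
        using H H' inj_on_the_inv_into[OF inj]
        by (subst map_pair_digraph_isomorphic) (auto intro: inj_on_subset)
      moreover have "map_prod ?g ?g ` parcs H \<subseteq> parcs T"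
      proof -
        have "map_prod ?g ?g ` parcs H \<subseteq> parcs (map_pair_digraph ?g (map_pair_digraph h T))"
          using H' by auto
        thus ?thesis using gh[OF wf] by simp
      qed
      moreover have "?g ` pverts H \<subseteq> pverts T"
        using H'(2) inj by (auto simp: the_inv_into_f_f)
      ultimately show "subgraph (with_proj (map_pair_digraph ?g H)) (with_proj T) \<and>
          map_pair_digraph ?g H \<cong> D"
        using wf H' by (auto simp: subgraph_pair_iff map_pair_digraph_wf)
    qed
  qed
  thus ?thesis
    unfolding num_copies_def by (simp add: bij_betw_same_card)
qed

lemma tournament_iff:
  "tournament T \<longleftrightarrow>
     finite (pverts T) \<and> parcs T \<subseteq> pverts T \<times> pverts T \<and> (\<forall>v. (v, v) \<notin> parcs T) \<and>
     (\<forall>u\<in>pverts T. \<forall>v\<in>pverts T. u \<noteq> v \<longrightarrow> ((u, v) \<in> parcs T \<longleftrightarrow> (v, u) \<notin> parcs T))"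
  (is "_ \<longleftrightarrow> ?R")
proof
  assume "tournament T"
  then obtain G where fin: "finite (pverts G)" and or: "orientation T G"
    and G: "parcs G = {(u, v). (u, v) \<in> pverts G \<times> pverts G \<and> u \<noteq> v}"
    unfolding tournament_def complete_digraph_pair_def by blast
  have V: "pverts T = pverts G" and sub: "parcs T \<subseteq> parcs G"
    and ex: "\<And>u v. (u, v) \<in> parcs G \<Longrightarrow> (u, v) \<in> parcs T \<longleftrightarrow> (v, u) \<notin> parcs T"
    using or unfolding orientation_def by blast+
  show ?R
    using fin sub ex unfolding V G by blast
next
  assume R: ?R
  let ?G = "\<lparr>pverts = pverts T, parcs = {(u, v). (u, v) \<in> pverts T \<times> pverts T \<and> u \<noteq> v}\<rparr>"
  have "complete_digraph (card (pverts T)) (with_proj ?G)"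
    using R by (simp add: complete_digraph_pair_def)
  moreover have "orientation T ?G"
    using R by (auto simp: orientation_def)
  ultimately show "tournament T" unfolding tournament_def by blast
qed

lemma converse_invariantD:
  fixes T :: "'b pair_pre_digraph"
  assumes "converse_invariant D" "tournament T"
  shows "num_copies T D = num_copies T (converse_digraph D)"
proof -
  have fin: "finite (pverts T)" and sub: "parcs T \<subseteq> pverts T \<times> pverts T"
    and irr: "\<And>v. (v, v) \<notin> parcs T"
    and ex: "\<And>u v. u \<in> pverts T \<Longrightarrow> v \<in> pverts T \<Longrightarrow> u \<noteq> v \<Longrightarrow>
      (u, v) \<in> parcs T \<longleftrightarrow> (v, u) \<notin> parcs T"
    using assms(2) unfolding tournament_iff by blast+
  have wf: "pair_wf_digraph T"
    using sub by (auto simp: pair_wf_digraph_def)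
  obtain h :: "'b \<Rightarrow> nat" where inj: "inj_on h (pverts T)"
    using finite_imp_inj_to_nat_seg[OF fin] by auto
  have mem: "(h u, h v) \<in> map_prod h h ` parcs T \<longleftrightarrow> (u, v) \<in> parcs T"
    if "u \<in> pverts T" "v \<in> pverts T" for u v
    using inj_on_image_mem_iff[OF map_prod_inj_on[OF inj inj], of "(u, v)" "parcs T"] that sub
    by simp
  have "tournament (map_pair_digraph h T)"
    unfolding tournament_iff map_pair_digraph_sel
  proof (intro conjI)
    show "finite (h ` pverts T)" using fin by simp
    show "map_prod h h ` parcs T \<subseteq> h ` pverts T \<times> h ` pverts T"
      using sub by auto
    show "\<forall>v. (v, v) \<notin> map_prod h h ` parcs T"
    proof (intro allI notI)
      fix v assume "(v, v) \<in> map_prod h h ` parcs T"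
      then obtain a b where "v = h a" "v = h b" and ab: "(a, b) \<in> parcs T" by fastforce
      from \<open>v = h a\<close> \<open>v = h b\<close> have "h a = h b" by simp
      moreover have "a \<in> pverts T" "b \<in> pverts T" using ab sub by auto
      ultimately have "a = b" using inj by (simp add: inj_on_eq_iff)
      thus False using ab irr by simp
    qed
    show "\<forall>u\<in>h ` pverts T. \<forall>v\<in>h ` pverts T. u \<noteq> v \<longrightarrow>
        ((u, v) \<in> map_prod h h ` parcs T \<longleftrightarrow> (v, u) \<notin> map_prod h h ` parcs T)"
    proof (intro ballI impI)
      fix u v assume "u \<in> h ` pverts T" "v \<in> h ` pverts T" "u \<noteq> v"
      then obtain a b where ab: "a \<in> pverts T" "b \<in> pverts T" "u = h a" "v = h b" "a \<noteq> b"
        by blast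
      have "(a, b) \<in> parcs T \<longleftrightarrow> (b, a) \<notin> parcs T"
        using ab by (intro ex)
      thus "(u, v) \<in> map_prod h h ` parcs T \<longleftrightarrow> (v, u) \<notin> map_prod h h ` parcs T"
        unfolding ab(3,4) mem[OF ab(1,2)] mem[OF ab(2,1)] .
    qed
  qed
  hence "num_copies (map_pair_digraph h T) D =
      num_copies (map_pair_digraph h T) (converse_digraph D)"
    using assms(1) unfolding converse_invariant_def by blast
  thus ?thesis
    unfolding num_copies_map_pair_digraph[OF wf inj] .
qed

end

theory Submission
  imports Defs
begin

text \<open>
  A tree of diameter at most three is a star or a double star (\<open>small_tree.double_star_structure\<close>).
  Choosing a central arc \<open>u \<rightarrow> v\<close>, its orientation is described up to isomorphism by the numbers
  \<open>p\<close>, \<open>q\<close>, \<open>r\<close>, \<open>s\<close> of in- and out-leaves of \<open>u\<close> and of in- and out-leaves of \<open>v\<close>. The converse has the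
  numbers \<open>s\<close>, \<open>r\<close>, \<open>q\<close>, \<open>p\<close>, and \<open>F\<close> has the numbers 2, 0, 2, 0.

  Converse invariance of an arbitrary oriented graph \<open>D\<close> is turned into algebra by averaging over
  random tournaments on the vertex set of \<open>D\<close>, in which \<open>(a, b)\<close> is an arc with probability
  \<open>\<omega> a b / 2\<close>, independently for different pairs. It says that the polynomial
  \<open>\<Sum>\<phi>. \<Prod>(a, b)\<in>parcs D. \<omega> (\<phi> a) (\<phi> b)\<close>, where \<open>\<phi>\<close> runs through the permutations of the vertices, is
  unchanged when \<open>\<omega>\<close> is transposed, for all \<open>\<omega>\<close> with \<open>\<omega> a b + \<omega> b a = 2\<close>
  (\<open>weighted_embeddings_converse\<close>). Weights that are biased only at one vertex give an identity
  between the degrees of the vertices of \<open>D\<close> (\<open>vertex_degree_identity\<close>), and weights that are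
  biased at two vertices give one between the degrees at the ends of the arcs
  (\<open>arc_degree_identity\<close>).

  For a double star these are exponential equations in \<open>p\<close>, \<open>q\<close>, \<open>r\<close>, \<open>s\<close>. The vertex identity with
  bias 1 and 2 leaves the double stars with \<open>(p, q) = (s, r)\<close>, the balanced stars, \<open>F\<close>, the converse
  of \<open>F\<close>, paths, and the exceptional families \<open>(q + 1, q, r, r + 1)\<close> and \<open>(0, 1, r, r + 1)\<close> with the
  converses of the latter; the arc identity excludes the members of these families that are neither
  paths nor isomorphic to their converse.

  Conversely, only \<open>F\<close> needs an argument. Reversing its central arc amounts to exchanging its two
  halves, so it suffices to count pairs of disjoint cherries, and every tournament contains as many
  in-cherries as out-cherries (\<open>card_embeddings_F_converse\<close>).
\<close>

section \<open>Copies and embeddings\<close>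

lemma converse_digraph_sel [simp]:
  "pverts (converse_digraph D) = pverts D"
  "parcs (converse_digraph D) = (parcs D)\<inverse>"
  by (simp_all add: converse_digraph_def)

lemma converse_converse_digraph [simp]: "converse_digraph (converse_digraph D) = D"
  by (simp add: converse_digraph_def)

lemma pair_wf_converse_digraph [simp]:
  "pair_wf_digraph (converse_digraph D) \<longleftrightarrow> pair_wf_digraph D"
  by (auto simp: pair_wf_digraph_def)

lemma map_converse_digraph:
  "map_pair_digraph f (converse_digraph D) = converse_digraph (map_pair_digraph f D)"
  by (auto simp: map_pair_digraph_def converse_digraph_def)

lemma converse_digraph_isomorphic_iff:
  "converse_digraph D \<cong> converse_digraph E \<longleftrightarrow> D \<cong> E"
  unfolding pair_digraph_isomorphic_iff pair_wf_converse_digraph converse_digraph_sel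
    map_converse_digraph
  by (metis converse_converse_digraph)

lemma digraph_isomorphic_trans_iff:
  assumes "D \<cong> E"
  shows "E \<cong> X \<longleftrightarrow> D \<cong> X"
  using assms by (auto simp: pair_digraph_isomorphic_iff[of D E] map_pair_digraph_isomorphic)

lemma digraph_isomorphic_refl: "pair_wf_digraph D \<Longrightarrow> D \<cong> D"
  unfolding pair_digraph_isomorphic_iff
  by (intro conjI exI[of _ id]) (auto simp: map_pair_digraph_inverse)

lemma digraph_isomorphic_sym:
  assumes "D \<cong> E"
  shows "E \<cong> D"
proof -
  have "pair_wf_digraph D"
    using assms by (simp add: pair_digraph_isomorphic_iff)
  thus ?thesis
    using digraph_isomorphic_trans_iff[OF assms] digraph_isomorphic_refl by blast
qed

lemma num_copies_cong:
  assumes "D \<cong> E"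
  shows "num_copies T D = num_copies T E"
proof -
  have eq: "H \<cong> D \<longleftrightarrow> H \<cong> E" for H
    using assms digraph_isomorphic_trans_iff[of H] digraph_isomorphic_trans_iff[OF assms]
      digraph_isomorphic_sym by metis
  show ?thesis unfolding num_copies_def eq ..
qed

text \<open>
  The functions are extensional so that there are only finitely many between finite sets.
\<close>

definition injections :: "'a set \<Rightarrow> 'b set \<Rightarrow> ('a \<Rightarrow> 'b) set" where
  "injections V W = {\<phi> \<in> V \<rightarrow>\<^sub>E W. inj_on \<phi> V}"

definition embeddings :: "'a pair_pre_digraph \<Rightarrow> 'b pair_pre_digraph \<Rightarrow> ('a \<Rightarrow> 'b) set" where
  "embeddings D T =
     {\<phi> \<in> injections (pverts D) (pverts T). map_prod \<phi> \<phi> ` parcs D \<subseteq> parcs T}"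

definition automorphisms :: "'a pair_pre_digraph \<Rightarrow> ('a \<Rightarrow> 'a) set" where
  "automorphisms D = {\<phi> \<in> injections (pverts D) (pverts D). map_pair_digraph \<phi> D = D}"

lemma finite_injections: "finite V \<Longrightarrow> finite W \<Longrightarrow> finite (injections V W)"
  unfolding injections_def by (rule finite_subset[OF _ finite_PiE]) auto

lemma injections_self_bij_betw:
  "finite V \<Longrightarrow> \<phi> \<in> injections V V \<Longrightarrow> bij_betw \<phi> V V"
  using endo_inj_surj[of V \<phi>] unfolding injections_def bij_betw_def PiE_def
  by blast

lemma restrict_id_injections: "restrict id V \<in> injections V V"
  by (auto simp: injections_def inj_on_def)

lemma automorphisms_converse: "automorphisms (converse_digraph D) = automorphisms D"
  unfolding automorphisms_def map_converse_digraph converse_digraph_sel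
  by (metis converse_converse_digraph)

lemma map_pair_digraph_cong:
  assumes "pair_wf_digraph D" "\<And>v. v \<in> pverts D \<Longrightarrow> f v = g v"
  shows "map_pair_digraph f D = map_pair_digraph g D"
proof -
  have "map_prod f f a = map_prod g g a" if "a \<in> parcs D" for a
    using assms that by (cases a) (auto simp: pair_wf_digraph_def)
  thus ?thesis using assms(2) by (simp add: map_pair_digraph_def cong: image_cong)
qed

lemma embeddings_iff:
  "\<phi> \<in> embeddings D T \<longleftrightarrow> \<phi> \<in> extensional (pverts D) \<and> inj_on \<phi> (pverts D) \<and>
     pverts (map_pair_digraph \<phi> D) \<subseteq> pverts T \<and> parcs (map_pair_digraph \<phi> D) \<subseteq> parcs T"
  by (auto simp: embeddings_def injections_def PiE_def)

lemma automorphisms_iff: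
  "\<phi> \<in> automorphisms D \<longleftrightarrow>
     \<phi> \<in> extensional (pverts D) \<and> inj_on \<phi> (pverts D) \<and> map_pair_digraph \<phi> D = D"
proof -
  have "\<phi> ` pverts D = pverts D" if "map_pair_digraph \<phi> D = D"
    using arg_cong[OF that, of pverts] by simp
  thus ?thesis
    by (auto simp: automorphisms_def injections_def PiE_def)
qed

text \<open>
  Copies are counted through embeddings, which are easier to sum over: two embeddings have the same
  image exactly when they differ by an automorphism.
\<close>

lemma card_embeddings:
  assumes D: "pair_wf_digraph D" "finite (pverts D)"
    and T: "pair_wf_digraph T" "finite (pverts T)"
  shows "card (embeddings D T) = num_copies T D * card (automorphisms D)"
proof -
  let ?V = "pverts D" and ?E = "embeddings D T"
  let ?img = "\<lambda>\<phi>. map_pair_digraph \<phi> D"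
  have fin: "finite ?E"
    using finite_injections[OF D(2) T(2)] by (simp add: embeddings_def)
  have img_comp: "?img (restrict (k \<circ> l) ?V) = map_pair_digraph k (?img l)"
    for k :: "'x \<Rightarrow> 'y" and l
    unfolding map_pair_digraph_comp by (rule map_pair_digraph_cong[OF D(1)]) simp
  have copies: "{H. subgraph (with_proj H) (with_proj T) \<and> H \<cong> D} = ?img ` ?E"
  proof (intro equalityI subsetI)
    fix H assume "H \<in> {H. subgraph (with_proj H) (with_proj T) \<and> H \<cong> D}"
    hence H: "subgraph (with_proj H) (with_proj T)" "D \<cong> H"
      using digraph_isomorphic_sym by blast+
    then obtain f where f: "inj_on f ?V" "H = ?img f"
      by (auto simp: pair_digraph_isomorphic_iff)
    have img: "?img (restrict f ?V) = H"
      unfolding f(2) by (rule map_pair_digraph_cong[OF D(1)]) simp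
    have "inj_on (restrict f ?V) ?V" using f(1) by (simp add: inj_on_def)
    hence "restrict f ?V \<in> ?E"
      unfolding embeddings_iff img using H(1) by (simp add: subgraph_pair_iff)
    thus "H \<in> ?img ` ?E" using img by blast
  next
    fix H assume "H \<in> ?img ` ?E"
    then obtain \<phi> where \<phi>: "\<phi> \<in> ?E" "H = ?img \<phi>" by blast
    have "D \<cong> H"
      using \<phi> D(1) unfolding pair_digraph_isomorphic_iff embeddings_iff by blast
    moreover have "subgraph (with_proj H) (with_proj T)"
      using \<phi> map_pair_digraph_wf[OF D(1)] T(1) unfolding subgraph_pair_iff embeddings_iff
      by blast
    ultimately show "H \<in> {H. subgraph (with_proj H) (with_proj T) \<and> H \<cong> D}"
      using digraph_isomorphic_sym by blast
  qed
  have fibre: "card {\<phi> \<in> ?E. ?img \<phi> = H} = card (automorphisms D)" if H: "H \<in> ?img ` ?E" for H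
  proof -
    obtain f where f: "f \<in> ?E" "H = ?img f" using H by blast
    have inj: "inj_on f ?V" using f(1) by (simp add: embeddings_iff)
    let ?g = "inv_into ?V f"
    have inv: "map_pair_digraph ?g H = D"
      unfolding f(2) map_pair_digraph_comp
      using inj by (intro map_pair_digraph_inverse D(1)) auto
    have im: "\<phi> ` ?V = f ` ?V" if "?img \<phi> = H" for \<phi>
      using arg_cong[OF that, of pverts] f(2) by simp
    have im_auto: "\<alpha> ` ?V = ?V" if "\<alpha> \<in> automorphisms D" for \<alpha>
      using that by (metis automorphisms_iff map_pair_digraph_sel(1))
    have E_eq: "\<phi> \<in> ?E \<and> ?img \<phi> = H \<longleftrightarrow>
        \<phi> \<in> extensional ?V \<and> inj_on \<phi> ?V \<and> ?img \<phi> = H" for \<phi>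
      using f unfolding embeddings_iff by metis
    have "bij_betw (\<lambda>\<alpha>. restrict (f \<circ> \<alpha>) ?V) (automorphisms D) {\<phi> \<in> ?E. ?img \<phi> = H}"
    proof (rule bij_betw_byWitness[where f' = "\<lambda>\<phi>. restrict (?g \<circ> \<phi>) ?V"])
      show "\<forall>\<alpha>\<in>automorphisms D. restrict (?g \<circ> restrict (f \<circ> \<alpha>) ?V) ?V = \<alpha>"
      proof
        fix \<alpha> assume \<alpha>: "\<alpha> \<in> automorphisms D"
        show "restrict (?g \<circ> restrict (f \<circ> \<alpha>) ?V) ?V = \<alpha>"
        proof (rule extensionalityI[where A = ?V])
          show "\<alpha> \<in> extensional ?V" using \<alpha> by (simp add: automorphisms_iff)
          fix x assume x: "x \<in> ?V"
          hence "\<alpha> x \<in> ?V" using im_auto[OF \<alpha>] by blast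
          thus "restrict (?g \<circ> restrict (f \<circ> \<alpha>) ?V) ?V x = \<alpha> x"
            using x inj by simp
        qed simp
      qed
      show "\<forall>\<phi>\<in>{\<phi> \<in> ?E. ?img \<phi> = H}. restrict (f \<circ> restrict (?g \<circ> \<phi>) ?V) ?V = \<phi>"
      proof
        fix \<phi> assume "\<phi> \<in> {\<phi> \<in> ?E. ?img \<phi> = H}"
        hence \<phi>: "\<phi> \<in> extensional ?V" "?img \<phi> = H" using E_eq by auto
        show "restrict (f \<circ> restrict (?g \<circ> \<phi>) ?V) ?V = \<phi>"
        proof (rule extensionalityI[where A = ?V])
          fix x assume x: "x \<in> ?V"
          hence "\<phi> x \<in> f ` ?V" using im[OF \<phi>(2)] by blast
          thus "restrict (f \<circ> restrict (?g \<circ> \<phi>) ?V) ?V x = \<phi> x"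
            using x by (simp add: f_inv_into_f)
        qed (use \<phi> in simp_all)
      qed
      show "(\<lambda>\<alpha>. restrict (f \<circ> \<alpha>) ?V) ` automorphisms D \<subseteq> {\<phi> \<in> ?E. ?img \<phi> = H}"
      proof (rule image_subsetI)
        fix \<alpha> assume \<alpha>: "\<alpha> \<in> automorphisms D"
        have "inj_on (f \<circ> \<alpha>) ?V"
          using \<alpha> inj im_auto[OF \<alpha>] by (intro comp_inj_on) (simp_all add: automorphisms_iff)
        hence "inj_on (restrict (f \<circ> \<alpha>) ?V) ?V" by (simp add: inj_on_def)
        moreover have "?img (restrict (f \<circ> \<alpha>) ?V) = H"
          using \<alpha> f(2) unfolding img_comp by (simp add: automorphisms_iff)
        ultimately show "restrict (f \<circ> \<alpha>) ?V \<in> {\<phi> \<in> ?E. ?img \<phi> = H}"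
          unfolding mem_Collect_eq E_eq by simp
      qed
      show "(\<lambda>\<phi>. restrict (?g \<circ> \<phi>) ?V) ` {\<phi> \<in> ?E. ?img \<phi> = H} \<subseteq> automorphisms D"
      proof (rule image_subsetI)
        fix \<phi> assume "\<phi> \<in> {\<phi> \<in> ?E. ?img \<phi> = H}"
        hence \<phi>: "inj_on \<phi> ?V" "?img \<phi> = H" using E_eq by auto
        have "inj_on (?g \<circ> \<phi>) ?V"
          using \<phi>(1) im[OF \<phi>(2)] by (intro comp_inj_on inj_on_inv_into) simp_all
        hence "inj_on (restrict (?g \<circ> \<phi>) ?V) ?V" by (simp add: inj_on_def)
        moreover have "?img (restrict (?g \<circ> \<phi>) ?V) = D"
          unfolding img_comp \<phi>(2) by (rule inv)
        ultimately show "restrict (?g \<circ> \<phi>) ?V \<in> automorphisms D"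
          unfolding automorphisms_iff by simp
      qed
    qed
    thus ?thesis by (simp add: bij_betw_same_card)
  qed
  have "card ?E = (\<Sum>H\<in>?img ` ?E. \<Sum>\<phi> | \<phi> \<in> ?E \<and> ?img \<phi> = H. 1)"
    using sum.group[of ?E "?img ` ?E" ?img "\<lambda>_. 1::nat"] fin by simp
  also have "\<dots> = (\<Sum>H\<in>?img ` ?E. card (automorphisms D))"
    by (intro sum.cong refl) (simp add: fibre)
  finally show ?thesis
    unfolding num_copies_def copies by simp
qed

text \<open>
  An oriented graph and its converse have the same automorphisms, so converse invariance can be
  tested on numbers of embeddings.
\<close>

lemma card_embeddings_converse_iff:
  assumes D: "pair_wf_digraph D" "finite (pverts D)"
    and T: "pair_wf_digraph T" "finite (pverts T)"
  shows "num_copies T D = num_copies T (converse_digraph D) \<longleftrightarrow>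
    card (embeddings D T) = card (embeddings (converse_digraph D) T)"
proof -
  have "restrict id (pverts D) \<in> automorphisms D"
    using D by (auto simp: automorphisms_def restrict_id_injections map_pair_digraph_inverse)
  moreover have "finite (automorphisms D)"
    by (rule finite_subset[OF _ finite_injections[OF D(2) D(2)]])
      (simp add: automorphisms_def)
  ultimately have "card (automorphisms D) \<noteq> 0" by auto
  thus ?thesis
    using card_embeddings[OF D T] card_embeddings[of "converse_digraph D" T] D T
    by (simp add: automorphisms_converse)
qed

section \<open>Random tournaments\<close>

definition oriented_graph :: "'a pair_pre_digraph \<Rightarrow> bool" where
  "oriented_graph D \<longleftrightarrow> pair_wf_digraph D \<and> finite (pverts D) \<and>
     (\<forall>a b. (a, b) \<in> parcs D \<longrightarrow> (b, a) \<notin> parcs D)"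

lemma oriented_graph_converse [simp]:
  "oriented_graph (converse_digraph D) \<longleftrightarrow> oriented_graph D"
  by (auto simp: oriented_graph_def)

lemma oriented_graph_arcs_subset: "oriented_graph D \<Longrightarrow> parcs D \<subseteq> pverts D \<times> pverts D"
  by (auto simp: oriented_graph_def pair_wf_digraph_def)

lemma oriented_graph_finite_arcs: "oriented_graph D \<Longrightarrow> finite (parcs D)"
  using oriented_graph_arcs_subset[of D] by (auto simp: oriented_graph_def intro: finite_subset)

text \<open>
  An orientation of a set of edges, of which \<open>P\<close> contains one direction each, is given by the set
  \<open>X\<close> of the pairs that keep their direction. If the edges are oriented independently, \<open>(a, b)\<close>
  being chosen with probability \<open>\<omega> a b / 2\<close>, then a set \<open>B\<close> of arcs is contained in the result with
  probability \<open>\<Prod>(a, b)\<in>B. \<omega> a b / 2\<close>; the identity is this statement multiplied by \<open>2 ^ card P\<close>.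
  It is a formal identity and holds for arbitrary integer weights with \<open>\<omega> a b + \<omega> b a = 2\<close>; weights
  outside \<open>{0..2}\<close> occur below.
\<close>

lemma sum_orientation_weights:
  fixes \<omega> :: "'a \<Rightarrow> 'a \<Rightarrow> int"
  assumes fin: "finite P" and asym: "\<And>a b. (a, b) \<in> P \<Longrightarrow> (b, a) \<notin> P"
    and two: "\<And>a b. (a, b) \<in> P \<Longrightarrow> \<omega> a b + \<omega> b a = 2"
    and B: "B \<subseteq> P \<union> P\<inverse>" "\<And>a b. (a, b) \<in> B \<Longrightarrow> (b, a) \<notin> B"
  shows "(\<Sum>X\<in>Pow P. (\<Prod>(a, b)\<in>X. \<omega> a b) * (\<Prod>(a, b)\<in>P - X. \<omega> b a) *
            of_bool (B \<subseteq> X \<union> (P - X)\<inverse>)) =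
         2 ^ (card P - card B) * (\<Prod>(a, b)\<in>B. \<omega> a b)"
proof -
  \<comment> \<open>\<open>f\<close> and \<open>g\<close> put the condition on \<open>B\<close> into the weights, so that the sum over \<open>X\<close> factors.\<close>
  define f where "f = (\<lambda>(a, b). \<omega> a b * of_bool ((b, a) \<notin> B))"
  define g where "g = (\<lambda>(a, b). \<omega> b a * of_bool ((a, b) \<notin> B))"
  define h where "h = (\<lambda>(a, b). if (a, b) \<in> P then (a, b) else (b, a))"
  let ?P' = "h ` B"
  have "(\<Prod>(a, b)\<in>X. \<omega> a b) * (\<Prod>(a, b)\<in>P - X. \<omega> b a) * of_bool (B \<subseteq> X \<union> (P - X)\<inverse>) =
      prod f X * prod g (P - X)" if X: "X \<in> Pow P" for X
  proof (cases "B \<subseteq> X \<union> (P - X)\<inverse>")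
    case True
    have "(b, a) \<notin> B" if "(a, b) \<in> X" for a b
      using True that X asym by blast
    hence "prod f X = (\<Prod>(a, b)\<in>X. \<omega> a b)"
      by (intro prod.cong) (auto simp: f_def)
    moreover have "(a, b) \<notin> B" if "(a, b) \<in> P - X" for a b
      using True that X asym by blast
    hence "prod g (P - X) = (\<Prod>(a, b)\<in>P - X. \<omega> b a)"
      by (intro prod.cong) (auto simp: g_def)
    ultimately show ?thesis using True by simp
  next
    case False
    then obtain a b where ab: "(a, b) \<in> B" "(a, b) \<notin> X \<union> (P - X)\<inverse>" by auto
    hence "(a, b) \<in> P - X \<or> (b, a) \<in> X" using B(1) by blast
    hence "prod f X * prod g (P - X) = 0"
    proof
      assume "(a, b) \<in> P - X"
      moreover have "g (a, b) = 0" using ab by (simp add: g_def)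
      ultimately have "prod g (P - X) = 0" using fin by (auto intro!: prod_zero)
      thus ?thesis by simp
    next
      assume "(b, a) \<in> X"
      moreover have "f (b, a) = 0" using ab by (simp add: f_def)
      ultimately have "prod f X = 0"
        using finite_subset[OF _ fin] X by (auto intro!: prod_zero)
      thus ?thesis by simp
    qed
    thus ?thesis using False by simp
  qed
  hence "(\<Sum>X\<in>Pow P. (\<Prod>(a, b)\<in>X. \<omega> a b) * (\<Prod>(a, b)\<in>P - X. \<omega> b a) *
            of_bool (B \<subseteq> X \<union> (P - X)\<inverse>)) = (\<Prod>e\<in>P. f e + g e)"
    unfolding prod_add[OF fin] by (rule sum.cong[OF refl])
  also have "\<dots> = (\<Prod>e\<in>P - ?P'. f e + g e) * (\<Prod>e\<in>?P'. f e + g e)"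
    using B(1) by (intro prod.subset_diff fin) (auto simp: h_def)
  also have "(\<Prod>e\<in>P - ?P'. f e + g e) = (\<Prod>e\<in>P - ?P'. 2)"
  proof (rule prod.cong[OF refl])
    fix e assume e: "e \<in> P - ?P'"
    obtain a b where ab: "e = (a, b)" by (cases e)
    have "(a, b) \<notin> B" "(b, a) \<notin> B"
      using e asym[of a b] unfolding ab by (force simp: h_def)+
    thus "f e + g e = 2" using e two by (simp add: ab f_def g_def)
  qed
  also have "\<dots> = 2 ^ (card P - card ?P')"
    using B(1) fin by (simp, subst card_Diff_subset) (auto simp: h_def intro: finite_subset)
  finally have "(\<Sum>X\<in>Pow P. (\<Prod>(a, b)\<in>X. \<omega> a b) * (\<Prod>(a, b)\<in>P - X. \<omega> b a) *
            of_bool (B \<subseteq> X \<union> (P - X)\<inverse>)) = 2 ^ (card P - card ?P') * (\<Prod>e\<in>?P'. f e + g e)" .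
  moreover have inj: "inj_on h B"
    using B(2) by (auto simp: inj_on_def h_def split: if_splits)
  moreover have "f (h e) + g (h e) = (case e of (a, b) \<Rightarrow> \<omega> a b)" if "e \<in> B" for e
    using that B(2) by (auto simp: f_def g_def h_def split: prod.splits)
  hence "(\<Prod>e\<in>?P'. f e + g e) = (\<Prod>(a, b)\<in>B. \<omega> a b)"
    by (simp add: prod.reindex[OF inj])
  ultimately show ?thesis by (simp add: card_image)
qed

lemma prod_converse:
  "(\<Prod>(a, b)\<in>A\<inverse>. f a b) = (\<Prod>(a, b)\<in>A. f b a)"
  by (rule prod.reindex_bij_witness[of _ prod.swap prod.swap]) auto

text \<open>
  The expected number of embeddings of \<open>D\<close> into a random tournament on the vertices of \<open>D\<close> equals
  that of its converse. The expectation of an embedding is a product of weights over the arcs, so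
  converse invariance becomes an identity between polynomials in the weights.
\<close>

lemma weighted_embeddings_converse:
  fixes \<omega> :: "'a \<Rightarrow> 'a \<Rightarrow> int"
  assumes D: "oriented_graph D" and inv: "converse_invariant D"
    and two: "\<And>a b. a \<noteq> b \<Longrightarrow> \<omega> a b + \<omega> b a = 2"
  defines "V \<equiv> pverts D"
  shows "(\<Sum>\<phi>\<in>injections V V. \<Prod>(a, b)\<in>parcs D. \<omega> (\<phi> a) (\<phi> b)) =
         (\<Sum>\<phi>\<in>injections V V. \<Prod>(a, b)\<in>parcs D. \<omega> (\<phi> b) (\<phi> a))"
proof -
  have finV: "finite V" using D by (simp add: oriented_graph_def V_def)
  obtain h :: "'a \<Rightarrow> nat" where h: "inj_on h V"
    using finite_imp_inj_to_nat_seg[OF finV] by auto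
  define P where "P = {(a, b). a \<in> V \<and> b \<in> V \<and> h a < h b}"
  define T where "T X = \<lparr>pverts = V, parcs = X \<union> (P - X)\<inverse>\<rparr>" for X
  define w where "w X = (\<Prod>(a, b)\<in>X. \<omega> a b) * (\<Prod>(a, b)\<in>P - X. \<omega> b a)" for X
  have P: "P \<subseteq> V \<times> V" "\<And>a b. (a, b) \<in> P \<Longrightarrow> (b, a) \<notin> P" by (auto simp: P_def)
  have P_total: "(a, b) \<in> P \<union> P\<inverse>" if "a \<in> V" "b \<in> V" "a \<noteq> b" for a b
  proof -
    have "h a \<noteq> h b" using that h by (auto simp: inj_on_def)
    thus ?thesis using that(1,2) by (auto simp: P_def)
  qed
  have finP: "finite P" using finV P(1) by (auto intro: finite_subset)
  have irr: "(a, a) \<notin> P" for a by (simp add: P_def)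
  have T: "tournament (T X)" "pair_wf_digraph (T X)" if "X \<in> Pow P" for X
  proof -
    have "(a, b) \<in> parcs (T X) \<longleftrightarrow> (b, a) \<notin> parcs (T X)" if "a \<in> V" "b \<in> V" "a \<noteq> b" for a b
      using P_total[OF that] P(2) \<open>X \<in> Pow P\<close> unfolding T_def by auto
    thus "tournament (T X)"
      using finV P that irr unfolding tournament_iff by (auto simp: T_def)
    show "pair_wf_digraph (T X)"
      using P that by (auto simp: T_def pair_wf_digraph_def)
  qed
  have count: "(\<Sum>X\<in>Pow P. w X * int (card (embeddings E (T X)))) =
      2 ^ (card P - card (parcs E)) *
        (\<Sum>\<phi>\<in>injections V V. \<Prod>(a, b)\<in>parcs E. \<omega> (\<phi> a) (\<phi> b))"
    if E: "oriented_graph E" "pverts E = V" for E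
  proof -
    have int_card: "int (card (embeddings E (T X))) =
        (\<Sum>\<phi>\<in>injections V V. of_bool (map_prod \<phi> \<phi> ` parcs E \<subseteq> X \<union> (P - X)\<inverse>))" for X
    proof -
      have "embeddings E (T X) = 
          {\<phi> \<in> injections V V. map_prod \<phi> \<phi> ` parcs E \<subseteq> X \<union> (P - X)\<inverse>}"
        using E(2) by (simp add: embeddings_def T_def)
      thus ?thesis
        by (simp add: of_bool_def sum.If_cases finite_injections finV Int_def)
    qed
    have "(\<Sum>X\<in>Pow P. w X * int (card (embeddings E (T X)))) =
        (\<Sum>\<phi>\<in>injections V V. \<Sum>X\<in>Pow P.
           w X * of_bool (map_prod \<phi> \<phi> ` parcs E \<subseteq> X \<union> (P - X)\<inverse>))"
      unfolding int_card sum_distrib_left by (rule sum.swap)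
    also have "\<dots> = (\<Sum>\<phi>\<in>injections V V. 2 ^ (card P - card (parcs E)) *
        (\<Prod>(a, b)\<in>parcs E. \<omega> (\<phi> a) (\<phi> b)))"
    proof (rule sum.cong[OF refl])
      fix \<phi> assume "\<phi> \<in> injections V V"
      hence \<phi>: "inj_on \<phi> V" "\<And>v. v \<in> V \<Longrightarrow> \<phi> v \<in> V"
        by (auto simp: injections_def)
      have arcs: "parcs E \<subseteq> V \<times> V" "\<And>a b. (a, b) \<in> parcs E \<Longrightarrow> (b, a) \<notin> parcs E"
        using E oriented_graph_arcs_subset[OF E(1)] by (auto simp: oriented_graph_def)
      have inj: "inj_on (map_prod \<phi> \<phi>) (parcs E)"
        using map_prod_inj_on[OF \<phi>(1) \<phi>(1)] arcs(1) by (rule inj_on_subset)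
      have asym: "(b, a) \<notin> map_prod \<phi> \<phi> ` parcs E" if "(a, b) \<in> map_prod \<phi> \<phi> ` parcs E" for a b
      proof
        assume "(b, a) \<in> map_prod \<phi> \<phi> ` parcs E"
        with that obtain x y x' y' where
          "(x, y) \<in> parcs E" "(y', x') \<in> parcs E" "\<phi> x = \<phi> x'" "\<phi> y = \<phi> y'"
          by (auto simp: map_prod_def)
        moreover from this have "x = x'" "y = y'"
          using arcs(1) \<phi>(1) by (auto simp: inj_on_def)
        ultimately show False using arcs(2) by blast
      qed
      have "\<phi> a \<in> V \<and> \<phi> b \<in> V \<and> \<phi> a \<noteq> \<phi> b" if "(a, b) \<in> parcs E" for a b
      proof -
        have "a \<in> V" "b \<in> V" "a \<noteq> b" using that arcs by auto
        thus ?thesis using \<phi> by (auto simp: inj_on_def)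
      qed
      hence "map_prod \<phi> \<phi> ` parcs E \<subseteq> P \<union> P\<inverse>"
        using P_total by (auto simp: map_prod_def)
      moreover have "\<omega> a b + \<omega> b a = 2" if "(a, b) \<in> P" for a b
        using that irr by (intro two) auto
      ultimately have "(\<Sum>X\<in>Pow P. w X * of_bool (map_prod \<phi> \<phi> ` parcs E \<subseteq> X \<union> (P - X)\<inverse>)) =
        2 ^ (card P - card (map_prod \<phi> \<phi> ` parcs E)) * (\<Prod>(a, b)\<in>map_prod \<phi> \<phi> ` parcs E. \<omega> a b)"
        unfolding w_def using finP P(2) asym by (intro sum_orientation_weights)
      also have "\<dots> = 2 ^ (card P - card (parcs E)) * (\<Prod>(a, b)\<in>parcs E. \<omega> (\<phi> a) (\<phi> b))"
        by (simp add: card_image[OF inj] prod.reindex[OF inj] split_beta)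
      finally show "(\<Sum>X\<in>Pow P. w X * of_bool (map_prod \<phi> \<phi> ` parcs E \<subseteq> X \<union> (P - X)\<inverse>)) =
        2 ^ (card P - card (parcs E)) * (\<Prod>(a, b)\<in>parcs E. \<omega> (\<phi> a) (\<phi> b))" .
    qed
    finally show ?thesis by (simp add: sum_distrib_left)
  qed
  have "card (embeddings D (T X)) = card (embeddings (converse_digraph D) (T X))"
    if "X \<in> Pow P" for X
    using converse_invariantD[OF inv T(1)[OF that]] card_embeddings_converse_iff[of D "T X"]
      D T(2)[OF that] finV
    by (simp add: oriented_graph_def T_def)
  hence "(\<Sum>X\<in>Pow P. w X * int (card (embeddings D (T X)))) =
      (\<Sum>X\<in>Pow P. w X * int (card (embeddings (converse_digraph D) (T X))))"
    by (intro sum.cong) simp_all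
  hence "(\<Sum>\<phi>\<in>injections V V. \<Prod>(a, b)\<in>parcs D. \<omega> (\<phi> a) (\<phi> b)) =
      (\<Sum>\<phi>\<in>injections V V. \<Prod>(a, b)\<in>(parcs D)\<inverse>. \<omega> (\<phi> a) (\<phi> b))"
    using count[of D] count[of "converse_digraph D"] D by (simp add: V_def)
  thus ?thesis unfolding prod_converse .
qed

section \<open>Degree identities\<close>

text \<open>
  Evaluating the polynomial identity at a weight that singles out certain vertices \<open>i\<close> and summing
  over all choices of \<open>i\<close> removes the sum over the embeddings: in the term of \<open>\<phi>\<close> one may replace
  \<open>i\<close> by its image under \<open>\<phi>\<close>, after which the term does not depend on \<open>\<phi>\<close>.
\<close>

lemma weight_family_converse:
  fixes \<Omega> :: "'i \<Rightarrow> 'a \<Rightarrow> 'a \<Rightarrow> int" and act :: "('a \<Rightarrow> 'a) \<Rightarrow> 'i \<Rightarrow> 'i"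
  assumes D: "oriented_graph D" and inv: "converse_invariant D"
  defines "V \<equiv> pverts D"
  assumes two: "\<And>i a b. i \<in> I \<Longrightarrow> a \<noteq> b \<Longrightarrow> \<Omega> i a b + \<Omega> i b a = 2"
    and act: "\<And>\<phi>. bij_betw \<phi> V V \<Longrightarrow> bij_betw (act \<phi>) I I"
    and equiv: "\<And>\<phi> i a b. bij_betw \<phi> V V \<Longrightarrow> i \<in> I \<Longrightarrow> a \<in> V \<Longrightarrow> b \<in> V \<Longrightarrow>
      \<Omega> (act \<phi> i) (\<phi> a) (\<phi> b) = \<Omega> i a b"
  shows "(\<Sum>i\<in>I. \<Prod>(a, b)\<in>parcs D. \<Omega> i a b) = (\<Sum>i\<in>I. \<Prod>(a, b)\<in>parcs D. \<Omega> i b a)"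
proof -
  have finV: "finite V" using D by (simp add: oriented_graph_def V_def)
  have arcs: "a \<in> V" "b \<in> V" if "(a, b) \<in> parcs D" for a b
    using oriented_graph_arcs_subset[OF D] that by (auto simp: V_def)
  have average: "(\<Sum>i\<in>I. \<Sum>\<phi>\<in>injections V V. g i \<phi>) =
      int (card (injections V V)) * (\<Sum>i\<in>I. k i)"
    if "\<And>\<phi> i. bij_betw \<phi> V V \<Longrightarrow> i \<in> I \<Longrightarrow> g (act \<phi> i) \<phi> = k i" for g k
  proof -
    have "(\<Sum>i\<in>I. g i \<phi>) = (\<Sum>i\<in>I. k i)" if "\<phi> \<in> injections V V" for \<phi>
    proof -
      have bij: "bij_betw \<phi> V V" by (rule injections_self_bij_betw[OF finV that])
      have "(\<Sum>i\<in>I. g i \<phi>) = (\<Sum>i\<in>I. g (act \<phi> i) \<phi>)"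
        by (rule sum.reindex_bij_betw[OF act[OF bij], symmetric])
      also have "\<dots> = (\<Sum>i\<in>I. k i)"
        using \<open>\<And>\<phi> i. _ \<Longrightarrow> _ \<Longrightarrow> g (act \<phi> i) \<phi> = k i\<close> bij by (intro sum.cong) auto
      finally show ?thesis .
    qed
    thus ?thesis by (subst sum.swap) simp
  qed
  have "(\<Sum>i\<in>I. \<Sum>\<phi>\<in>injections V V. \<Prod>(a, b)\<in>parcs D. \<Omega> i (\<phi> a) (\<phi> b)) =
      (\<Sum>i\<in>I. \<Sum>\<phi>\<in>injections V V. \<Prod>(a, b)\<in>parcs D. \<Omega> i (\<phi> b) (\<phi> a))"
    unfolding V_def using two by (intro sum.cong refl weighted_embeddings_converse[OF D inv])
  moreover have "(\<Sum>i\<in>I. \<Sum>\<phi>\<in>injections V V. \<Prod>(a, b)\<in>parcs D. \<Omega> i (\<phi> a) (\<phi> b)) =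
      int (card (injections V V)) * (\<Sum>i\<in>I. \<Prod>(a, b)\<in>parcs D. \<Omega> i a b)"
    using equiv arcs by (intro average prod.cong) auto
  moreover have "(\<Sum>i\<in>I. \<Sum>\<phi>\<in>injections V V. \<Prod>(a, b)\<in>parcs D. \<Omega> i (\<phi> b) (\<phi> a)) =
      int (card (injections V V)) * (\<Sum>i\<in>I. \<Prod>(a, b)\<in>parcs D. \<Omega> i b a)"
    using equiv arcs by (intro average prod.cong) auto
  moreover have "card (injections V V) \<noteq> 0"
    using finite_injections[OF finV finV] restrict_id_injections by auto
  ultimately show ?thesis by simp
qed

definition outdeg :: "'a rel \<Rightarrow> 'a \<Rightarrow> nat" where
  "outdeg A z = card (A `` {z})"

abbreviation indeg :: "'a rel \<Rightarrow> 'a \<Rightarrow> nat" where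
  "indeg A \<equiv> outdeg (A\<inverse>)"

text \<open>
  All arcs are unbiased except those at the vertex \<open>c\<close>, which tend to leave \<open>c\<close> with bias \<open>t\<close>.
\<close>

definition vertex_weight :: "'a \<Rightarrow> int \<Rightarrow> 'a \<Rightarrow> 'a \<Rightarrow> int" where
  "vertex_weight c t a b = (if a = c then 1 + t else if b = c then 1 - t else 1)"

lemma prod_vertex_weight:
  assumes fin: "finite A" and irr: "\<And>a. (a, a) \<notin> A"
  shows "(\<Prod>(a, b)\<in>A. vertex_weight z t a b) = (1 + t) ^ outdeg A z * (1 - t) ^ indeg A z"
proof -
  let ?O = "{z} \<times> A `` {z}" and ?I = "A\<inverse> `` {z} \<times> {z}"
  let ?R = "A - ?O - ?I"
  have A: "A = ?O \<union> ?I \<union> ?R" by auto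
  have fins: "finite (A `` {z})" "finite (A\<inverse> `` {z})"
    using fin by (auto intro: finite_Image)
  have "(\<Prod>(a, b)\<in>A. vertex_weight z t a b) =
      (\<Prod>(a, b)\<in>?O. vertex_weight z t a b) * (\<Prod>(a, b)\<in>?I. vertex_weight z t a b) *
      (\<Prod>(a, b)\<in>?R. vertex_weight z t a b)"
    using fins fin irr by (subst A, subst prod.union_disjoint, simp, simp, blast,
        subst prod.union_disjoint) auto
  also have "(\<Prod>(a, b)\<in>?O. vertex_weight z t a b) = (\<Prod>e\<in>?O. 1 + t)"
    by (intro prod.cong) (auto simp: vertex_weight_def)
  also have "(\<Prod>(a, b)\<in>?I. vertex_weight z t a b) = (\<Prod>e\<in>?I. 1 - t)"
    using irr by (intro prod.cong) (auto simp: vertex_weight_def)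
  also have "(\<Prod>(a, b)\<in>?R. vertex_weight z t a b) = 1"
    by (intro prod.neutral) (auto simp: vertex_weight_def split: if_splits)
  finally show ?thesis
    by (simp add: outdeg_def card_cartesian_product)
qed

lemma oriented_graph_arcsD:
  assumes "oriented_graph D"
  shows "finite (parcs D)" "\<And>a. (a, a) \<notin> parcs D" "\<And>a b. (a, b) \<in> parcs D \<Longrightarrow> (b, a) \<notin> parcs D"
    "\<And>a b. (a, b) \<in> parcs D \<Longrightarrow> a \<in> pverts D \<and> b \<in> pverts D"
  using assms oriented_graph_finite_arcs[OF assms] oriented_graph_arcs_subset[OF assms]
  by (auto simp: oriented_graph_def)

text \<open>
  With one biased vertex, only the degrees of the vertex that is mapped there matter.
\<close>

lemma vertex_degree_identity:
  fixes t :: int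
  assumes D: "oriented_graph D" and inv: "converse_invariant D"
  defines "A \<equiv> parcs D"
  shows "(\<Sum>z\<in>pverts D. (1 + t) ^ outdeg A z * (1 - t) ^ indeg A z) =
         (\<Sum>z\<in>pverts D. (1 - t) ^ outdeg A z * (1 + t) ^ indeg A z)"
proof -
  have "(\<Sum>z\<in>pverts D. \<Prod>(a, b)\<in>A. vertex_weight z t a b) =
      (\<Sum>z\<in>pverts D. \<Prod>(a, b)\<in>A. vertex_weight z t b a)"
    unfolding A_def
  proof (rule weight_family_converse[OF D inv, where act = "\<lambda>\<phi>. \<phi>"])
    fix \<phi> i a b assume "bij_betw \<phi> (pverts D) (pverts D)" "i \<in> pverts D" "a \<in> pverts D" "b \<in> pverts D"
    hence "\<phi> a = \<phi> i \<longleftrightarrow> a = i" "\<phi> b = \<phi> i \<longleftrightarrow> b = i"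
      by (auto simp: bij_betw_def inj_on_def)
    thus "vertex_weight (\<phi> i) t (\<phi> a) (\<phi> b) = vertex_weight i t a b"
      by (simp add: vertex_weight_def)
  qed (auto simp: vertex_weight_def)
  moreover have "(\<Prod>(a, b)\<in>A. vertex_weight z t a b) =
      (1 + t) ^ outdeg A z * (1 - t) ^ indeg A z" for z
    unfolding A_def by (intro prod_vertex_weight oriented_graph_arcsD[OF D])
  moreover have "(\<Prod>(a, b)\<in>A. vertex_weight z t b a) =
      (1 - t) ^ outdeg A z * (1 + t) ^ indeg A z" for z
    using prod_vertex_weight[of "A\<inverse>" z t] oriented_graph_arcsD(1,2)[OF D]
    unfolding prod_converse by (simp add: A_def mult.commute)
  ultimately show ?thesis by simp
qed

text \<open>
  For an arc from \<open>z\<close> to \<open>w\<close>, this is the weight of all the other arcs when \<open>z\<close> is biased by \<open>s\<close>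
  and \<open>w\<close> by \<open>t\<close>. The subtractions of 1 remove the arc itself from the degrees, so they never
  truncate.
\<close>

definition arc_weight :: "'a rel \<Rightarrow> int \<Rightarrow> int \<Rightarrow> 'a \<Rightarrow> 'a \<Rightarrow> int" where
  "arc_weight A s t z w =
     (1 + s) ^ (outdeg A z - 1) * (1 - s) ^ indeg A z *
     ((1 + t) ^ outdeg A w * (1 - t) ^ (indeg A w - 1))"

lemma prod_two_vertex_weights:
  assumes fin: "finite A" and irr: "\<And>a. (a, a) \<notin> A" and zw: "(z, w) \<in> A"
  shows "(\<Prod>(a, b)\<in>A - {(z, w)}. vertex_weight z s a b * vertex_weight w t a b) = arc_weight A s t z w"
proof -
  let ?A = "A - {(z, w)}"
  have fins: "finite (A `` {x})" "finite (A\<inverse> `` {x})" for x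
    using fin by (auto intro: finite_Image)
  have [simp]: "z \<noteq> w" "w \<noteq> z" using zw irr by auto
  have "?A `` {z} = A `` {z} - {w}" "?A\<inverse> `` {w} = A\<inverse> `` {w} - {z}"
    "?A\<inverse> `` {z} = A\<inverse> `` {z}" "?A `` {w} = A `` {w}"
    by auto
  hence "outdeg ?A z = outdeg A z - 1" "indeg ?A w = indeg A w - 1"
    "indeg ?A z = indeg A z" "outdeg ?A w = outdeg A w"
    using zw fins by (simp_all add: outdeg_def)
  moreover have "(\<Prod>(a, b)\<in>?A. vertex_weight z s a b * vertex_weight w t a b) =
      (\<Prod>(a, b)\<in>?A. vertex_weight z s a b) * (\<Prod>(a, b)\<in>?A. vertex_weight w t a b)"
    unfolding prod.distrib[symmetric] by (simp add: split_beta)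
  ultimately show ?thesis
    using fin irr by (simp add: prod_vertex_weight arc_weight_def)
qed

text \<open>
  With two biased vertices \<open>c\<close> and \<open>d\<close>, the identity is affine in the bias \<open>m\<close> of the arc between
  them. Its coefficient of \<open>m\<close> is isolated by subtracting the values at \<open>m = - 1\<close> from those at
  \<open>m = 1\<close>; only pairs of adjacent vertices contribute to it, and an arc of \<open>D\<close> contributes twice,
  as it can be mapped to \<open>(c, d)\<close> or to \<open>(d, c)\<close>.
\<close>

lemma arc_degree_identity:
  fixes D :: "'a pair_pre_digraph" and s t :: int
  assumes D: "oriented_graph D" and inv: "converse_invariant D"
  defines "A \<equiv> parcs D"
  shows "(\<Sum>(z, w)\<in>A. arc_weight A s t z w + arc_weight A (- s) (- t) z w) =
         (\<Sum>(z, w)\<in>A. arc_weight A t s z w + arc_weight A (- t) (- s) z w)"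
proof -
  let ?V = "pverts D"
  let ?I = "{(c, d). c \<in> ?V \<and> d \<in> ?V \<and> c \<noteq> d}"
  define \<Omega> :: "int \<Rightarrow> 'a \<times> 'a \<Rightarrow> 'a \<Rightarrow> 'a \<Rightarrow> int"
    where "\<Omega> m = (\<lambda>(c, d) a b. if (a, b) = (c, d) then 1 + m
      else if (b, a) = (c, d) then 1 - m
      else vertex_weight c s a b * vertex_weight d t a b)" for m
  let ?act = "\<lambda>\<phi>. map_prod \<phi> (\<phi> :: 'a \<Rightarrow> 'a)"
  note arcs = oriented_graph_arcsD[OF D, folded A_def]
  have finI: "finite ?I"
    using D by (auto simp: oriented_graph_def intro: finite_subset[of _ "?V \<times> ?V"])
  have identity: "(\<Sum>i\<in>?I. \<Prod>(a, b)\<in>A. \<Omega> m i a b) = (\<Sum>i\<in>?I. \<Prod>(a, b)\<in>A. \<Omega> m i b a)" for m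
    unfolding A_def
  proof (rule weight_family_converse[OF D inv, where act = ?act])
    fix \<phi> assume \<phi>: "bij_betw \<phi> ?V ?V"
    have mem: "\<phi> x \<in> ?V" if "x \<in> ?V" for x
      using bij_betwE[OF \<phi>] that by blast
    have eq_iff: "\<phi> x = \<phi> y \<longleftrightarrow> x = y" if "x \<in> ?V" "y \<in> ?V" for x y
      using inj_on_eq_iff[OF bij_betw_imp_inj_on[OF \<phi>]] that by blast
    have "bij_betw (?act \<phi>) (?V \<times> ?V) (?V \<times> ?V)" by (rule bij_betw_map_prod[OF \<phi> \<phi>])
    moreover have "?act \<phi> ` ?I = ?I"
    proof -
      have "(c, d) \<in> ?act \<phi> ` ?I" if "(c, d) \<in> ?I" for c d
      proof -
        have "c \<in> \<phi> ` ?V" "d \<in> \<phi> ` ?V"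
          using that bij_betw_imp_surj_on[OF \<phi>] by auto
        then obtain c' d' where "c' \<in> ?V" "c = \<phi> c'" "d' \<in> ?V" "d = \<phi> d'"
          by blast
        thus ?thesis using that by (auto intro!: image_eqI[of _ _ "(c', d')"])
      qed
      moreover have "?act \<phi> i \<in> ?I" if "i \<in> ?I" for i
        using that by (auto simp: mem eq_iff)
      ultimately show ?thesis by auto
    qed
    ultimately show "bij_betw (?act \<phi>) ?I ?I"
      by (elim bij_betw_subset) auto
  next
    fix \<phi> i a b assume \<phi>: "bij_betw \<phi> ?V ?V" and i: "i \<in> ?I" and ab: "a \<in> ?V" "b \<in> ?V"
    have "\<phi> x = \<phi> y \<longleftrightarrow> x = y" if "x \<in> ?V" "y \<in> ?V" for x y
      using inj_on_eq_iff[OF bij_betw_imp_inj_on[OF \<phi>]] that by blast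
    thus "\<Omega> m (?act \<phi> i) (\<phi> a) (\<phi> b) = \<Omega> m i a b"
      using i ab by (auto simp: \<Omega>_def vertex_weight_def)
  qed (auto simp: \<Omega>_def vertex_weight_def)
  have sum_diff: "(\<Sum>(z, w)\<in>B. f z w - g z w) = (\<Sum>(z, w)\<in>B. f z w) - (\<Sum>(z, w)\<in>B. g z w)"
    for f g :: "'a \<Rightarrow> 'a \<Rightarrow> int" and B
    by (simp add: split_beta sum_subtractf)
  have difference: "(\<Sum>i\<in>?I. (\<Prod>(a, b)\<in>B. \<Omega> 1 i a b) - (\<Prod>(a, b)\<in>B. \<Omega> (- 1) i a b)) =
      2 * (\<Sum>(z, w)\<in>B. arc_weight B s t z w - arc_weight B t s z w)"
    if B: "finite B" "\<And>a. (a, a) \<notin> B" "\<And>a b. (a, b) \<in> B \<Longrightarrow> (b, a) \<notin> B"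
      "\<And>a b. (a, b) \<in> B \<Longrightarrow> a \<in> ?V \<and> b \<in> ?V" for B
  proof -
    have eq: "(\<Prod>(a, b)\<in>B. \<Omega> 1 (z, w) a b) - (\<Prod>(a, b)\<in>B. \<Omega> (- 1) (z, w) a b) =
        2 * ((if (z, w) \<in> B then arc_weight B s t z w else 0) -
             (if (w, z) \<in> B then arc_weight B t s w z else 0))" for z w
    proof -
      have rest: "(\<Prod>(a, b)\<in>C. \<Omega> m (z, w) a b) =
          (\<Prod>(a, b)\<in>C. vertex_weight z s a b * vertex_weight w t a b)"
        if "(z, w) \<notin> C" "(w, z) \<notin> C" for C m
      proof (rule prod.cong[OF refl])
        fix e assume "e \<in> C"
        moreover obtain a b where "e = (a, b)" by (cases e)
        ultimately have "(a, b) \<noteq> (z, w)" "(b, a) \<noteq> (z, w)" using that by auto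
        thus "(case e of (a, b) \<Rightarrow> \<Omega> m (z, w) a b) =
            (case e of (a, b) \<Rightarrow> vertex_weight z s a b * vertex_weight w t a b)"
          unfolding \<open>e = (a, b)\<close> \<Omega>_def by (simp only: prod.case if_False)
      qed
      consider "(z, w) \<in> B" "(w, z) \<notin> B" | "(w, z) \<in> B" "(z, w) \<notin> B" | "(z, w) \<notin> B" "(w, z) \<notin> B"
        using B(3) by blast
      thus ?thesis
      proof cases
        case 1
        have "(\<Prod>(a, b)\<in>B. \<Omega> m (z, w) a b) = (1 + m) * arc_weight B s t z w" for m
        proof -
          have "\<Omega> m (z, w) z w = 1 + m" by (simp add: \<Omega>_def)
          moreover have "(\<Prod>(a, b)\<in>B - {(z, w)}. \<Omega> m (z, w) a b) = arc_weight B s t z w"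
            using 1 by (simp add: rest prod_two_vertex_weights[OF B(1,2)])
          ultimately show ?thesis
            using prod.remove[OF B(1) 1(1), of "\<lambda>(a, b). \<Omega> m (z, w) a b"] by simp
        qed
        thus ?thesis using 1 by simp
      next
        case 2
        have "(\<Prod>(a, b)\<in>B. \<Omega> m (z, w) a b) = (1 - m) * arc_weight B t s w z" for m
        proof -
          have "\<Omega> m (z, w) w z = 1 - m" using 2 by (auto simp: \<Omega>_def)
          moreover have "(\<Prod>(a, b)\<in>B - {(w, z)}. \<Omega> m (z, w) a b) = arc_weight B t s w z"
            using 2 prod_two_vertex_weights[OF B(1,2) 2(1), of t s]
            by (simp add: rest mult.commute)
          ultimately show ?thesis
            using prod.remove[OF B(1) 2(1), of "\<lambda>(a, b). \<Omega> m (z, w) a b"] by simp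
        qed
        thus ?thesis using 2 by simp
      next
        case 3
        thus ?thesis by (simp add: rest)
      qed
    qed
    have "(\<Sum>i\<in>?I. (\<Prod>(a, b)\<in>B. \<Omega> 1 i a b) - (\<Prod>(a, b)\<in>B. \<Omega> (- 1) i a b)) =
        2 * ((\<Sum>(z, w)\<in>?I. if (z, w) \<in> B then arc_weight B s t z w else 0) -
             (\<Sum>(z, w)\<in>?I. if (w, z) \<in> B then arc_weight B t s w z else 0))"
      unfolding sum_subtractf[symmetric] sum_distrib_left
      by (intro sum.cong refl) (auto simp: eq)
    also have "(\<Sum>(z, w)\<in>?I. if (z, w) \<in> B then arc_weight B s t z w else 0) =
        (\<Sum>(z, w)\<in>B. arc_weight B s t z w)"
      using finI B by (intro sum.mono_neutral_cong_right) (auto split: if_splits)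
    also have "(\<Sum>(z, w)\<in>?I. if (w, z) \<in> B then arc_weight B t s w z else 0) =
        (\<Sum>(z, w)\<in>B\<inverse>. arc_weight B t s w z)"
      using finI B by (intro sum.mono_neutral_cong_right) (auto split: if_splits)
    also have "\<dots> = (\<Sum>(z, w)\<in>B. arc_weight B t s z w)"
      by (rule sum.reindex_bij_witness[of _ prod.swap prod.swap]) auto
    finally show ?thesis unfolding sum_diff .
  qed
  have "(\<Sum>(z, w)\<in>A. arc_weight A s t z w - arc_weight A t s z w) =
      (\<Sum>(z, w)\<in>A\<inverse>. arc_weight (A\<inverse>) s t z w - arc_weight (A\<inverse>) t s z w)"
  proof -
    have "(\<Sum>i\<in>?I. (\<Prod>(a, b)\<in>A. \<Omega> 1 i a b) - (\<Prod>(a, b)\<in>A. \<Omega> (- 1) i a b)) =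
        (\<Sum>i\<in>?I. (\<Prod>(a, b)\<in>A\<inverse>. \<Omega> 1 i a b) - (\<Prod>(a, b)\<in>A\<inverse>. \<Omega> (- 1) i a b))"
      unfolding sum_subtractf prod_converse using identity by simp
    moreover have "(\<Sum>i\<in>?I. (\<Prod>(a, b)\<in>A. \<Omega> 1 i a b) - (\<Prod>(a, b)\<in>A. \<Omega> (- 1) i a b)) =
      2 * (\<Sum>(z, w)\<in>A. arc_weight A s t z w - arc_weight A t s z w)"
      using arcs by (intro difference) auto
    moreover have "(\<Sum>i\<in>?I. (\<Prod>(a, b)\<in>A\<inverse>. \<Omega> 1 i a b) - (\<Prod>(a, b)\<in>A\<inverse>. \<Omega> (- 1) i a b)) =
      2 * (\<Sum>(z, w)\<in>A\<inverse>. arc_weight (A\<inverse>) s t z w - arc_weight (A\<inverse>) t s z w)"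
      using arcs by (intro difference) auto
    ultimately show ?thesis by simp
  qed
  also have "\<dots> = (\<Sum>(z, w)\<in>A. arc_weight A (- t) (- s) z w - arc_weight A (- s) (- t) z w)"
    by (rule sum.reindex_bij_witness[of _ prod.swap prod.swap])
      (auto simp: arc_weight_def algebra_simps)
  finally show ?thesis by (simp add: split_beta sum_subtractf sum.distrib)
qed

section \<open>Converse invariance of the digraph F\<close>

lemma F_vertex_UNIV: "(UNIV :: F_vertex set) = {Fu, Fv, Fx, Fu', Fy, Fv'}"
  using F_vertex.exhaust by blast

lemma sum_injections_permute:
  fixes g :: "('a \<Rightarrow> 'b) \<Rightarrow> int"
  assumes "\<And>x. \<pi> (\<pi> x) = x"
  shows "(\<Sum>\<phi>\<in>injections UNIV W. g (\<phi> \<circ> \<pi>)) = (\<Sum>\<phi>\<in>injections UNIV W. g \<phi>)"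
proof -
  have "inj \<pi>" using assms by (rule inj_on_inverseI)
  hence "\<phi> \<circ> \<pi> \<in> injections UNIV W" if "\<phi> \<in> injections UNIV W" for \<phi> :: "'a \<Rightarrow> 'b"
    using that by (auto simp: injections_def intro: inj_compose)
  moreover have "\<phi> \<circ> \<pi> \<circ> \<pi> = \<phi>" for \<phi> :: "'a \<Rightarrow> 'b"
    using assms by (simp add: fun_eq_iff)
  ultimately show ?thesis
    by (intro sum.reindex_bij_witness[of _ "\<lambda>\<phi>. \<phi> \<circ> \<pi>" "\<lambda>\<phi>. \<phi> \<circ> \<pi>"]) auto
qed

text \<open>
  Exchanging the two halves of \<open>F\<close> reverses only the central arc, so the embeddings of \<open>F\<close> are one
  half of the pairs of vertex-disjoint in-cherries (two arcs into a common vertex); likewise the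
  embeddings of the converse are one half of the pairs of disjoint out-cherries. These numbers agree
  because a tournament has equally many in-cherries and out-cherries on every vertex set: expanding
  \<open>(1 - e x u) (1 - e x' u)\<close>, where \<open>e\<close> indicates an arc, the terms other than \<open>e x u * e x' u\<close>
  cancel because each single arc is present for one half of the injections.
\<close>

lemma card_embeddings_F_converse:
  fixes T :: "'a pair_pre_digraph"
  assumes T: "tournament T"
  shows "card (embeddings digraph_F T) = card (embeddings (converse_digraph digraph_F) T)"
proof -
  define e :: "F_vertex \<Rightarrow> F_vertex \<Rightarrow> (F_vertex \<Rightarrow> 'a) \<Rightarrow> int"
    where "e a b \<phi> = of_bool ((\<phi> a, \<phi> b) \<in> parcs T)" for a b \<phi>
  define S :: "((F_vertex \<Rightarrow> 'a) \<Rightarrow> int) \<Rightarrow> int"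
    where "S g = (\<Sum>\<phi>\<in>injections UNIV (pverts T). g \<phi>)" for g
  define mirror where "mirror = (\<lambda>x. case x of Fu \<Rightarrow> Fv | Fv \<Rightarrow> Fu | Fx \<Rightarrow> Fy | Fy \<Rightarrow> Fx
      | Fu' \<Rightarrow> Fv' | Fv' \<Rightarrow> Fu')"
  define swap where "swap a = id(Fu := a, a := Fu)" for a
  have fin: "finite (injections (UNIV :: F_vertex set) (pverts T))"
    using T by (intro finite_injections) (simp_all add: F_vertex_UNIV tournament_iff)
  have e_conv: "e b a \<phi> = 1 - e a b \<phi>" if "\<phi> \<in> injections UNIV (pverts T)" "a \<noteq> b" for a b \<phi>
  proof -
    have "\<phi> a \<in> pverts T" "\<phi> b \<in> pverts T" "\<phi> a \<noteq> \<phi> b"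
      using that by (auto simp: injections_def inj_on_def)
    hence "(\<phi> b, \<phi> a) \<in> parcs T \<longleftrightarrow> (\<phi> a, \<phi> b) \<notin> parcs T"
      using T unfolding tournament_iff by metis
    thus ?thesis by (simp add: e_def)
  qed
  have S_cong: "S f = S g" if "\<And>\<phi>. \<phi> \<in> injections UNIV (pverts T) \<Longrightarrow> f \<phi> = g \<phi>" for f g
    unfolding S_def using that by (rule sum.cong[OF refl])
  have S_add: "S (\<lambda>\<phi>. f \<phi> + g \<phi>) = S f + S g" and S_diff: "S (\<lambda>\<phi>. f \<phi> - g \<phi>) = S f - S g" for f g
    by (simp_all add: S_def sum.distrib sum_subtractf)
  have S_mirror: "S (\<lambda>\<phi>. g (\<phi> \<circ> mirror)) = S g" for g
    unfolding S_def by (rule sum_injections_permute) (simp add: mirror_def split: F_vertex.splits)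
  have S_swap: "S (\<lambda>\<phi>. g (\<phi> \<circ> swap a)) = S g" for g a
    unfolding S_def by (rule sum_injections_permute) (simp add: swap_def)
  have e_comp: "e a b (\<phi> \<circ> \<pi>) = e (\<pi> a) (\<pi> b) \<phi>" for a b \<phi> \<pi>
    by (simp add: e_def)
  have half: "2 * S (\<lambda>\<phi>. e a Fu \<phi> * g \<phi>) = S g"
    if "\<And>\<phi>. g (\<phi> \<circ> swap a) = g \<phi>" "a \<noteq> Fu" for a g
  proof -
    have "S (\<lambda>\<phi>. e a Fu \<phi> * g \<phi>) = S (\<lambda>\<phi>. e Fu a \<phi> * g \<phi>)"
      using S_swap[of "\<lambda>\<phi>. e a Fu \<phi> * g \<phi>" a] that by (simp add: e_comp swap_def)
    also have "\<dots> = S (\<lambda>\<phi>. g \<phi> - e a Fu \<phi> * g \<phi>)"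
      using that by (intro S_cong) (simp add: e_conv[of _ a Fu] algebra_simps)
    finally show ?thesis by (simp add: S_diff)
  qed
  have cherry: "S (\<lambda>\<phi>. e Fu Fx \<phi> * e Fu Fu' \<phi> * g \<phi>) = S (\<lambda>\<phi>. e Fx Fu \<phi> * e Fu' Fu \<phi> * g \<phi>)"
    if "\<And>\<phi>. g (\<phi> \<circ> swap Fx) = g \<phi>" "\<And>\<phi>. g (\<phi> \<circ> swap Fu') = g \<phi>" for g
  proof -
    have "S (\<lambda>\<phi>. e Fu Fx \<phi> * e Fu Fu' \<phi> * g \<phi>) =
        S (\<lambda>\<phi>. (g \<phi> - e Fx Fu \<phi> * g \<phi> - e Fu' Fu \<phi> * g \<phi>) + e Fx Fu \<phi> * e Fu' Fu \<phi> * g \<phi>)"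
      by (intro S_cong) (simp add: e_conv[of _ Fx Fu] e_conv[of _ Fu' Fu] algebra_simps)
    thus ?thesis
      using half[of g Fx] half[of g Fu'] that by (simp add: S_add S_diff)
  qed
  \<comment> \<open>In- and out-cherries at \<open>Fu\<close> and at \<open>Fv\<close>, as 0-1 indicators.\<close>
  define c where "c \<phi> = e Fx Fu \<phi> * e Fu' Fu \<phi>" for \<phi>
  define c' where "c' \<phi> = e Fu Fx \<phi> * e Fu Fu' \<phi>" for \<phi>
  define d where "d \<phi> = e Fy Fv \<phi> * e Fv' Fv \<phi>" for \<phi>
  define d' where "d' \<phi> = e Fv Fy \<phi> * e Fv Fv' \<phi>" for \<phi>
  note cd = c_def c'_def d_def d'_def
  have centre: "2 * S (\<lambda>\<phi>. g \<phi> * e a b \<phi>) = S g"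
    if "\<And>\<phi>. g (\<phi> \<circ> mirror) = g \<phi>" "(a, b) = (Fu, Fv) \<or> (a, b) = (Fv, Fu)" for g a b
  proof -
    have "S (\<lambda>\<phi>. g \<phi> * e a b \<phi>) = S (\<lambda>\<phi>. g \<phi> * e b a \<phi>)"
      using S_mirror[of "\<lambda>\<phi>. g \<phi> * e a b \<phi>"] that by (auto simp: e_comp mirror_def)
    also have "\<dots> = S (\<lambda>\<phi>. g \<phi> - g \<phi> * e a b \<phi>)"
    proof (rule S_cong)
      fix \<phi> :: "F_vertex \<Rightarrow> 'a" assume "\<phi> \<in> injections UNIV (pverts T)"
      moreover have "a \<noteq> b" using that(2) by auto
      ultimately show "g \<phi> * e b a \<phi> = g \<phi> - g \<phi> * e a b \<phi>"
        by (simp add: e_conv[of \<phi> a b] algebra_simps)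
    qed
    finally show ?thesis by (simp add: S_diff)
  qed
  have card_S: "int (card {\<phi> \<in> injections UNIV (pverts T). P \<phi>}) = S (\<lambda>\<phi>. of_bool (P \<phi>))" for P
    using fin by (simp add: S_def of_bool_def sum.If_cases Int_def)
  have card_F: "int (card (embeddings digraph_F T)) = S (\<lambda>\<phi>. (c \<phi> * d \<phi>) * e Fu Fv \<phi>)"
  proof -
    have "embeddings digraph_F T = {\<phi> \<in> injections UNIV (pverts T). (c \<phi> * d \<phi>) * e Fu Fv \<phi> = 1}"
      by (auto simp: embeddings_def digraph_F_def F_vertex_UNIV cd e_def split: if_splits)
    moreover have "of_bool ((c \<phi> * d \<phi>) * e Fu Fv \<phi> = 1) = (c \<phi> * d \<phi>) * e Fu Fv \<phi>" for \<phi>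
      by (simp add: cd e_def)
    ultimately show ?thesis
      by (simp only: card_S)
  qed
  have card_F': "int (card (embeddings (converse_digraph digraph_F) T)) =
      S (\<lambda>\<phi>. (c' \<phi> * d' \<phi>) * e Fv Fu \<phi>)"
  proof -
    have "embeddings (converse_digraph digraph_F) T =
        {\<phi> \<in> injections UNIV (pverts T). (c' \<phi> * d' \<phi>) * e Fv Fu \<phi> = 1}"
      by (auto simp: embeddings_def digraph_F_def F_vertex_UNIV cd e_def split: if_splits)
    moreover have "of_bool ((c' \<phi> * d' \<phi>) * e Fv Fu \<phi> = 1) = (c' \<phi> * d' \<phi>) * e Fv Fu \<phi>" for \<phi>
      by (simp add: cd e_def)
    ultimately show ?thesis
      by (simp only: card_S)
  qed
  have "2 * int (card (embeddings digraph_F T)) = S (\<lambda>\<phi>. c \<phi> * d \<phi>)"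
    unfolding card_F by (rule centre) (simp_all add: cd e_comp mirror_def)
  also have "\<dots> = S (\<lambda>\<phi>. c' \<phi> * d \<phi>)"
    unfolding c_def c'_def by (rule cherry[symmetric]) (simp_all add: cd e_comp swap_def)
  also have "\<dots> = S (\<lambda>\<phi>. c \<phi> * d' \<phi>)"
    using S_mirror[of "\<lambda>\<phi>. c' \<phi> * d \<phi>"] by (simp add: cd e_comp mirror_def mult_ac)
  also have "\<dots> = S (\<lambda>\<phi>. c' \<phi> * d' \<phi>)"
    unfolding c_def c'_def by (rule cherry[symmetric]) (simp_all add: cd e_comp swap_def)
  also have "\<dots> = 2 * int (card (embeddings (converse_digraph digraph_F) T))"
    unfolding card_F' by (rule centre[symmetric]) (simp_all add: cd e_comp mirror_def)
  finally show ?thesis by simp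
qed

lemma F_converse_invariant:
  assumes "tournament T"
  shows "num_copies T digraph_F = num_copies T (converse_digraph digraph_F)"
proof -
  have "pair_wf_digraph digraph_F" "finite (pverts digraph_F)"
    by (auto simp: digraph_F_def pair_wf_digraph_def)
  moreover have "pair_wf_digraph T" "finite (pverts T)"
    using assms unfolding tournament_iff pair_wf_digraph_def by auto
  ultimately show ?thesis
    using card_embeddings_converse_iff card_embeddings_F_converse[OF assms] by blast
qed

section \<open>Oriented double stars\<close>

text \<open>
  The central arc goes from \<open>u\<close> to \<open>v\<close>; \<open>Iu\<close> and \<open>Ou\<close> are the leaves whose arc enters or leaves
  \<open>u\<close>, and \<open>Iv\<close> and \<open>Ov\<close> are those at \<open>v\<close>. Either end may have no leaves, so that stars are
  included.
\<close>

definition double_star ::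
  "'a pair_pre_digraph \<Rightarrow> 'a \<Rightarrow> 'a \<Rightarrow> 'a set \<Rightarrow> 'a set \<Rightarrow> 'a set \<Rightarrow> 'a set \<Rightarrow> bool" where
  "double_star D u v Iu Ou Iv Ov \<longleftrightarrow>
     finite Iu \<and> finite Ou \<and> finite Iv \<and> finite Ov \<and>
     u \<noteq> v \<and> {u, v} \<inter> (Iu \<union> Ou \<union> Iv \<union> Ov) = {} \<and>
     Iu \<inter> Ou = {} \<and> Iv \<inter> Ov = {} \<and> (Iu \<union> Ou) \<inter> (Iv \<union> Ov) = {} \<and>
     pverts D = {u, v} \<union> (Iu \<union> Ou) \<union> (Iv \<union> Ov) \<and>
     parcs D = {(u, v)} \<union> (Iu \<times> {u} \<union> {u} \<times> Ou) \<union> (Iv \<times> {v} \<union> {v} \<times> Ov)"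

lemma double_star_oriented_graph:
  "double_star D u v Iu Ou Iv Ov \<Longrightarrow> oriented_graph D"
  unfolding double_star_def oriented_graph_def pair_wf_digraph_def by auto

lemma double_star_converse:
  "double_star D u v Iu Ou Iv Ov \<Longrightarrow> double_star (converse_digraph D) v u Ov Iv Ou Iu"
  unfolding double_star_def by auto

lemma double_star_isomorphic:
  assumes D: "double_star D u v Iu Ou Iv Ov" and E: "double_star E u' v' Iu' Ou' Iv' Ov'"
    and card: "card Iu = card Iu'" "card Ou = card Ou'" "card Iv = card Iv'" "card Ov = card Ov'"
  shows "D \<cong> E"
proof -
  have fin: "finite Iu" "finite Ou" "finite Iv" "finite Ov"
    "finite Iu'" "finite Ou'" "finite Iv'" "finite Ov'"
    using D E by (auto simp: double_star_def)
  obtain f1 f2 f3 f4 where f: "bij_betw f1 Iu Iu'" "bij_betw f2 Ou Ou'" "bij_betw f3 Iv Iv'"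
    "bij_betw f4 Ov Ov'"
    using fin card by (meson finite_same_card_bij)
  define f where "f x = (if x = u then u' else if x = v then v' else if x \<in> Iu then f1 x
      else if x \<in> Ou then f2 x else if x \<in> Iv then f3 x else f4 x)" for x
  have uv: "f u = u'" "f v = v'" using D by (auto simp: f_def double_star_def)
  have parts: "bij_betw f {u} {u'}" "bij_betw f {v} {v'}"
    "bij_betw f Iu Iu'" "bij_betw f Ou Ou'" "bij_betw f Iv Iv'" "bij_betw f Ov Ov'"
  proof -
    show "bij_betw f {u} {u'}" "bij_betw f {v} {v'}" using uv by auto
    show "bij_betw f Iu Iu'" using D by (subst bij_betw_cong[of _ _ f1]) (auto simp: f_def double_star_def f)
    show "bij_betw f Ou Ou'" using D by (subst bij_betw_cong[of _ _ f2]) (auto simp: f_def double_star_def f)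
    show "bij_betw f Iv Iv'" using D by (subst bij_betw_cong[of _ _ f3]) (auto simp: f_def double_star_def f)
    show "bij_betw f Ov Ov'" using D by (subst bij_betw_cong[of _ _ f4]) (auto simp: f_def double_star_def f)
  qed
  have V: "bij_betw f ({u} \<union> {v} \<union> (Iu \<union> Ou) \<union> (Iv \<union> Ov)) ({u'} \<union> {v'} \<union> (Iu' \<union> Ou') \<union> (Iv' \<union> Ov'))"
    using E unfolding double_star_def by (intro bij_betw_combine parts) auto
  have times: "map_prod f f ` (X \<times> Y) = f ` X \<times> f ` Y" for X Y by auto
  have images: "f ` Iu = Iu'" "f ` Ou = Ou'" "f ` Iv = Iv'" "f ` Ov = Ov'"
    using parts by (simp_all add: bij_betw_def)
  have "pverts D = {u} \<union> {v} \<union> (Iu \<union> Ou) \<union> (Iv \<union> Ov)" "pverts E = {u'} \<union> {v'} \<union> (Iu' \<union> Ou') \<union> (Iv' \<union> Ov')"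
    using D E by (auto simp: double_star_def)
  hence "inj_on f (pverts D)" "f ` pverts D = pverts E"
    using V by (auto simp: bij_betw_def)
  moreover have "map_prod f f ` parcs D = parcs E"
  proof -
    have "map_prod f f ` parcs D =
        {(f u, f v)} \<union> (f ` Iu \<times> {f u} \<union> {f u} \<times> f ` Ou) \<union> (f ` Iv \<times> {f v} \<union> {f v} \<times> f ` Ov)"
      using D unfolding double_star_def by (simp add: image_Un times)
    also have "\<dots> = parcs E"
      using E unfolding double_star_def images uv by simp
    finally show ?thesis .
  qed
  ultimately have "E = map_pair_digraph f D"
    by (simp add: map_pair_digraph_def)
  thus ?thesis
    using \<open>inj_on f (pverts D)\<close> double_star_oriented_graph[OF D]
    by (auto simp: pair_digraph_isomorphic_iff oriented_graph_def)
qed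

lemma double_star_degrees:
  assumes "double_star D u v Iu Ou Iv Ov"
  defines "A \<equiv> parcs D"
  shows "outdeg A u = Suc (card Ou)" "indeg A u = card Iu"
    and "outdeg A v = card Ov" "indeg A v = Suc (card Iv)"
    and "x \<in> Iu \<union> Iv \<Longrightarrow> outdeg A x = 1" "x \<in> Iu \<union> Iv \<Longrightarrow> indeg A x = 0"
    and "x \<in> Ou \<union> Ov \<Longrightarrow> outdeg A x = 0" "x \<in> Ou \<union> Ov \<Longrightarrow> indeg A x = 1"
proof -
  note D = assms(1)[unfolded double_star_def]
  have "A `` {u} = insert v Ou" "A\<inverse> `` {u} = Iu" "A `` {v} = Ov" "A\<inverse> `` {v} = insert u Iv"
    using D by (auto simp: A_def)
  moreover have "v \<notin> Ou" "u \<notin> Iv" using D by auto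
  ultimately show "outdeg A u = Suc (card Ou)" "indeg A u = card Iu"
    "outdeg A v = card Ov" "indeg A v = Suc (card Iv)"
    using D by (simp_all add: outdeg_def)
  assume "x \<in> Iu \<union> Iv"
  hence "A `` {x} = {u} \<or> A `` {x} = {v}" "A\<inverse> `` {x} = {}" using D by (auto simp: A_def)
  thus "outdeg A x = 1" "indeg A x = 0" by (auto simp: outdeg_def)
next
  note D = assms(1)[unfolded double_star_def]
  assume "x \<in> Ou \<union> Ov"
  hence "A\<inverse> `` {x} = {u} \<or> A\<inverse> `` {x} = {v}" "A `` {x} = {}" using D by (auto simp: A_def)
  thus "outdeg A x = 0" "indeg A x = 1" by (auto simp: outdeg_def)
qed

lemma double_star_sum_vertices:
  fixes g :: "nat \<Rightarrow> nat \<Rightarrow> int"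
  assumes D: "double_star D u v Iu Ou Iv Ov"
  shows "(\<Sum>z\<in>pverts D. g (outdeg (parcs D) z) (indeg (parcs D) z)) =
    g (Suc (card Ou)) (card Iu) + g (card Ov) (Suc (card Iv)) +
    int (card Iu + card Iv) * g 1 0 + int (card Ou + card Ov) * g 0 1"
proof -
  note D' = D[unfolded double_star_def]
  note deg = double_star_degrees[OF D]
  let ?h = "\<lambda>z. g (outdeg (parcs D) z) (indeg (parcs D) z)"
  have V: "pverts D = {u, v} \<union> ((Iu \<union> Iv) \<union> (Ou \<union> Ov))" using D' by auto
  have "sum ?h (pverts D) = sum ?h {u, v} + (sum ?h (Iu \<union> Iv) + sum ?h (Ou \<union> Ov))"
  proof -
    have "sum ?h ((Iu \<union> Iv) \<union> (Ou \<union> Ov)) = sum ?h (Iu \<union> Iv) + sum ?h (Ou \<union> Ov)"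
      using D' by (intro sum.union_disjoint) auto
    moreover have "sum ?h (pverts D) = sum ?h {u, v} + sum ?h ((Iu \<union> Iv) \<union> (Ou \<union> Ov))"
      unfolding V using D' by (intro sum.union_disjoint) auto
    ultimately show ?thesis by simp
  qed
  also have "sum ?h {u, v} = g (Suc (card Ou)) (card Iu) + g (card Ov) (Suc (card Iv))"
    using D' deg by simp
  also have "sum ?h (Iu \<union> Iv) = int (card (Iu \<union> Iv)) * g 1 0"
    using deg(5,6) by simp
  also have "card (Iu \<union> Iv) = card Iu + card Iv"
    using D' by (intro card_Un_disjoint) auto
  also have "sum ?h (Ou \<union> Ov) = int (card (Ou \<union> Ov)) * g 0 1"
    using deg(7,8) by simp
  also have "card (Ou \<union> Ov) = card Ou + card Ov"
    using D' by (intro card_Un_disjoint) auto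
  finally show ?thesis by simp
qed

lemma double_star_sum_arcs:
  fixes k :: "'a \<Rightarrow> 'a \<Rightarrow> int"
  assumes D: "double_star D u v Iu Ou Iv Ov"
    and k: "\<And>x. x \<in> Iu \<Longrightarrow> k x u = k1" "\<And>x. x \<in> Ou \<Longrightarrow> k u x = k2"
      "\<And>x. x \<in> Iv \<Longrightarrow> k x v = k3" "\<And>x. x \<in> Ov \<Longrightarrow> k v x = k4"
  shows "(\<Sum>(z, w)\<in>parcs D. k z w) =
    k u v + int (card Iu) * k1 + int (card Ou) * k2 + int (card Iv) * k3 + int (card Ov) * k4"
proof -
  note D' = D[unfolded double_star_def]
  let ?S = "sum (\<lambda>(z, w). k z w)"
  have "?S (parcs D) = ?S {(u, v)} + (?S (Iu \<times> {u}) + ?S ({u} \<times> Ou)) + (?S (Iv \<times> {v}) + ?S ({v} \<times> Ov))"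
  proof -
    have "?S (Iu \<times> {u} \<union> {u} \<times> Ou) = ?S (Iu \<times> {u}) + ?S ({u} \<times> Ou)"
      using D' by (intro sum.union_disjoint) auto
    moreover have "?S (Iv \<times> {v} \<union> {v} \<times> Ov) = ?S (Iv \<times> {v}) + ?S ({v} \<times> Ov)"
      using D' by (intro sum.union_disjoint) auto
    moreover have "?S ({(u, v)} \<union> (Iu \<times> {u} \<union> {u} \<times> Ou)) = ?S {(u, v)} + ?S (Iu \<times> {u} \<union> {u} \<times> Ou)"
      using D' by (intro sum.union_disjoint) auto
    moreover have "?S (({(u, v)} \<union> (Iu \<times> {u} \<union> {u} \<times> Ou)) \<union> (Iv \<times> {v} \<union> {v} \<times> Ov)) =
        ?S ({(u, v)} \<union> (Iu \<times> {u} \<union> {u} \<times> Ou)) + ?S (Iv \<times> {v} \<union> {v} \<times> Ov)"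
      using D' by (intro sum.union_disjoint) auto
    ultimately show ?thesis using D' by simp
  qed
  moreover have "?S (Iu \<times> {u}) = int (card Iu) * k1" "?S ({u} \<times> Ou) = int (card Ou) * k2"
    "?S (Iv \<times> {v}) = int (card Iv) * k3" "?S ({v} \<times> Ov) = int (card Ov) * k4"
    using k by (simp_all flip: sum.cartesian_product)
  ultimately show ?thesis by simp
qed

text \<open>
  The sums of the degree identities, for a double star with \<open>p\<close>, \<open>q\<close>, \<open>r\<close>, \<open>s\<close> leaves of the
  four kinds \<open>Iu\<close>, \<open>Ou\<close>, \<open>Iv\<close>, \<open>Ov\<close>. The exponents \<open>p - 1\<close> and \<open>s - 1\<close> come with the factors \<open>p\<close>
  and \<open>s\<close>, so their truncation at 0 has no effect.
\<close>

definition star_sum :: "nat \<Rightarrow> nat \<Rightarrow> nat \<Rightarrow> nat \<Rightarrow> int \<Rightarrow> int" where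
  "star_sum p q r s t =
     (1 + t) ^ Suc q * (1 - t) ^ p + (1 + t) ^ s * (1 - t) ^ Suc r +
     int (p + r) * (1 + t) + int (q + s) * (1 - t)"

definition arc_sum :: "nat \<Rightarrow> nat \<Rightarrow> nat \<Rightarrow> nat \<Rightarrow> int \<Rightarrow> int \<Rightarrow> int" where
  "arc_sum p q r s x y =
     (1 + x) ^ q * (1 - x) ^ p * ((1 + y) ^ s * (1 - y) ^ r) +
     int p * ((1 + y) ^ Suc q * (1 - y) ^ (p - 1)) + int q * ((1 + x) ^ q * (1 - x) ^ p) +
     int r * ((1 + y) ^ s * (1 - y) ^ r) + int s * ((1 + x) ^ (s - 1) * (1 - x) ^ Suc r)"

lemma converse_invariant_double_star:
  assumes D: "double_star D u v Iu Ou Iv Ov" and inv: "converse_invariant D"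
  defines "p \<equiv> card Iu" and "q \<equiv> card Ou" and "r \<equiv> card Iv" and "s \<equiv> card Ov"
  shows "star_sum p q r s t = star_sum p q r s (- t)"
    and "arc_sum p q r s x y + arc_sum p q r s (- x) (- y) =
         arc_sum p q r s y x + arc_sum p q r s (- y) (- x)"
proof -
  let ?A = "parcs D"
  note or = double_star_oriented_graph[OF D]
  note deg = double_star_degrees[OF D]
  have "(\<Sum>z\<in>pverts D. (1 + t) ^ outdeg ?A z * (1 - t) ^ indeg ?A z) = star_sum p q r s t" for t
    using double_star_sum_vertices[OF D, of "\<lambda>a b. (1 + t) ^ a * (1 - t) ^ b"]
    by (simp add: star_sum_def p_def q_def r_def s_def)
  from this[of t] this[of "- t"] vertex_degree_identity[OF or inv, of t]
  show "star_sum p q r s t = star_sum p q r s (- t)" by simp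
  have arcs: "(\<Sum>(z, w)\<in>?A. arc_weight ?A x y z w) = arc_sum p q r s x y" for x y
  proof -
    have "(\<Sum>(z, w)\<in>?A. arc_weight ?A x y z w) = arc_weight ?A x y u v +
      int p * ((1 + y) ^ Suc q * (1 - y) ^ (p - 1)) + int q * ((1 + x) ^ q * (1 - x) ^ p) +
      int r * ((1 + y) ^ s * (1 - y) ^ r) + int s * ((1 + x) ^ (s - 1) * (1 - x) ^ Suc r)"
      unfolding p_def q_def r_def s_def
      by (intro double_star_sum_arcs[OF D]) (simp_all add: arc_weight_def deg)
    thus ?thesis
      by (simp add: arc_sum_def arc_weight_def deg p_def q_def r_def s_def)
  qed
  have split: "(\<Sum>(z, w)\<in>?A. f z w + g z w) = (\<Sum>(z, w)\<in>?A. f z w) + (\<Sum>(z, w)\<in>?A. g z w)"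
    for f g :: "'a \<Rightarrow> 'a \<Rightarrow> int"
    by (simp add: split_beta sum.distrib)
  show "arc_sum p q r s x y + arc_sum p q r s (- x) (- y) =
         arc_sum p q r s y x + arc_sum p q r s (- y) (- x)"
    using arc_degree_identity[OF or inv, of x y] unfolding split arcs .
qed

section \<open>Solving the degree identities\<close>

text \<open>
  The parameters 1 and 2 suffice. At 1 the biased vertex is a source, so that only vertices without
  in-arcs, or without out-arcs, are seen; at 2 the two bias factors are 3 and -1, and products of
  equally many of both are powers of -3, which determine their exponent.
\<close>

lemma power_neg3_inject:
  assumes "(- 3 :: int) ^ m = (- 3) ^ n"
  shows "m = n"
proof -
  have "\<bar>- 3 :: int\<bar> ^ m = \<bar>- 3\<bar> ^ n"
    using assms by (metis power_abs)
  thus ?thesis by simp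
qed

lemma power_neg3: "(- 1) ^ n * 3 ^ n = (- 3 :: int) ^ n" "3 ^ n * (- 1) ^ n = (- 3 :: int) ^ n"
  by (simp_all flip: power_mult_distrib)

lemma star_sum_identity_at_1:
  assumes "star_sum p q r s 1 = star_sum p q r s (- 1)"
  shows "0 ^ p * 2 ^ q + int (p + r) = 0 ^ s * 2 ^ r + int (q + s)"
  using assms by (simp add: star_sum_def mult.commute)

lemma star_sum_identity_at_2:
  assumes "star_sum p q r s 2 = star_sum p q r s (- 2)"
  shows "3 * 3 ^ q * (- 1) ^ p + (- 1) ^ q * 3 ^ p + 4 * int (p + r) =
    3 ^ s * (- 1) ^ r + 3 * (- 1) ^ s * 3 ^ r + 4 * int (q + s)"
  using assms by (simp add: star_sum_def algebra_simps)

text \<open>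
  The value at 1 gives \<open>p - q = s - r\<close>. Calling this difference \<open>d\<close>, the identity at 2 reads
  \<open>(-3) ^ q * h d = (-3) ^ r * h d\<close> with \<open>h d = 3 * (-1) ^ d + 3 ^ d\<close>, and \<open>h\<close> vanishes only at
  \<open>d = 1\<close>. Negative \<open>d\<close> is treated separately, with the roles of \<open>p\<close> and \<open>q\<close> exchanged.
\<close>

lemma star_sum_both_positive:
  assumes star: "star_sum p q r s 1 = star_sum p q r s (- 1)" "star_sum p q r s 2 = star_sum p q r s (- 2)"
    and pos: "p > 0" "s > 0"
  shows "(p = s \<and> q = r) \<or> (p = Suc q \<and> s = Suc r)"
proof -
  have sum: "p + r = q + s" using star_sum_identity_at_1[OF star(1)] pos by (simp add: power_0_left)
  have two: "3 * 3 ^ q * (- 1) ^ p + (- 1) ^ q * 3 ^ p =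
    3 ^ s * (- 1) ^ r + 3 * (- 1) ^ s * (3 :: int) ^ r"
    using star_sum_identity_at_2[OF star(2)] unfolding sum by simp
  show ?thesis
  proof (cases "p \<le> q")
    case True
    then obtain d where d: "q = p + d" by (auto simp: le_iff_add)
    have r: "r = s + d" using sum d by simp
    have "(- 3) ^ p * (3 * 3 ^ d + (- 1) ^ d) = (- 3) ^ s * (3 * 3 ^ d + (- 1 :: int) ^ d)"
      using two unfolding d r by (simp add: power_add algebra_simps flip: power_neg3)
    moreover have "3 * 3 ^ d + (- 1 :: int) ^ d \<noteq> 0"
    proof -
      have "(1 :: int) \<le> 3 ^ d" by simp
      moreover have "(- 1 :: int) ^ d \<ge> - 1" by (cases "even d") auto
      ultimately show ?thesis by linarith
    qed
    ultimately have "p = s" using power_neg3_inject by (metis mult_cancel_right)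
    thus ?thesis using d r by simp
  next
    case False
    then obtain d where d: "p = q + d" by (metis le_iff_add nat_le_linear)
    have s: "s = r + d" using sum d by simp
    have eq: "(- 3) ^ q * (3 * (- 1) ^ d + 3 ^ d) = (- 3) ^ r * (3 * (- 1) ^ d + (3 :: int) ^ d)"
      using two unfolding d s by (simp add: power_add algebra_simps flip: power_neg3)
    show ?thesis
    proof (cases "3 * (- 1) ^ d + (3 :: int) ^ d = 0")
      case True
      have "odd d"
      proof
        assume "even d"
        hence "3 + (3 :: int) ^ d = 0" using True by simp
        moreover have "(3 :: int) ^ d > 0" by simp
        ultimately show False by linarith
      qed
      hence "(3 :: int) ^ d = 3 ^ 1" using True by simp
      hence "d = 1" by (subst (asm) power_inject_exp) auto
      thus ?thesis using d s by simp
    next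
      case False
      hence "q = r" using eq power_neg3_inject by (metis mult_cancel_right)
      thus ?thesis using d s by simp
    qed
  qed
qed

text \<open>The function \<open>2 ^ n - n\<close> is injective apart from its equal values at 0 and 1.\<close>

lemma star_sum_both_zero:
  assumes star: "star_sum 0 q r 0 1 = star_sum 0 q r 0 (- 1)"
  shows "q = r \<or> (q \<le> 1 \<and> r \<le> 1)"
proof -
  have eq: "2 ^ q + int r = 2 ^ r + int q"
    using star_sum_identity_at_1[OF star] by simp
  have mono: "2 ^ m + int n < 2 ^ n + int m" if mn: "m < n" "n \<ge> 2" for m n
  proof -
    obtain d where d: "n = m + Suc d" using mn(1) by (auto simp: less_iff_Suc_add)
    have pow: "(2 :: int) ^ n = 2 ^ m * 2 * 2 ^ d" unfolding d by (simp add: power_add)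
    have "int d < 2 ^ d" by (simp add: of_nat_less_two_power)
    hence ge: "int d + 1 \<le> 2 ^ d" by linarith
    show ?thesis
    proof (cases m)
      case 0
      hence "d \<ge> 1" using mn d by simp
      hence "(2 :: int) ^ d \<ge> 2" using power_increasing[of 1 d "2 :: int"] by simp
      thus ?thesis using ge pow d 0 by simp
    next
      case (Suc k)
      hence "(2 :: int) ^ m \<ge> 2" by simp
      hence "(2 :: int) ^ m * (2 * 2 ^ d - 1) \<ge> 2 * (2 * 2 ^ d - 1)"
        using ge by (intro mult_right_mono) auto
      thus ?thesis using ge pow d by (simp add: algebra_simps)
    qed
  qed
  have "\<not> (q < r \<and> r \<ge> 2)" "\<not> (r < q \<and> q \<ge> 2)"
    using eq mono[of q r] mono[of r q] by force+
  thus ?thesis by linarith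
qed

text \<open>
  Here \<open>s - r = 2 ^ q - q\<close>. For \<open>q \<ge> 3\<close> the powers \<open>3 ^ s\<close> and \<open>3 ^ r\<close> in the identity at 2 are then
  too far apart to be balanced by \<open>3 ^ q\<close>. The case \<open>q = 2\<close> leaves only the converse of \<open>F\<close>. For
  \<open>q = 1\<close>, as in the case \<open>p = Suc q\<close>, \<open>s = Suc r\<close> above, the vertex identity holds for every
  parameter; such double stars are excluded by the arc identity in the next two lemmas.
\<close>

lemma star_sum_zero_positive:
  assumes star: "star_sum 0 q r s 1 = star_sum 0 q r s (- 1)" "star_sum 0 q r s 2 = star_sum 0 q r s (- 2)"
    and pos: "s > 0"
  shows "(q \<le> 1 \<and> s = Suc r) \<or> (q = 2 \<and> r = 0 \<and> s = 2)"
proof -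
  have one: "int s = 2 ^ q - int q + int r"
    using star_sum_identity_at_1[OF star(1)] pos by (simp add: power_0_left)
  have two: "3 * 3 ^ q + (- 1) ^ q + 4 * int r =
    3 ^ s * (- 1) ^ r + 3 * (- 1) ^ s * (3 :: int) ^ r + 4 * int (q + s)"
    using star_sum_identity_at_2[OF star(2)] by simp
  consider "q = 0" | "q = 1" | "q = 2" | "q \<ge> 3" by linarith
  thus ?thesis
  proof cases
    case 3
    have s: "s = r + 2" using one 3 by simp
    have "12 * ((- 1) ^ r * 3 ^ r) = (12 :: int)"
      using two unfolding s 3 by (simp add: power_add algebra_simps)
    hence "(- 3) ^ r = (- 3 :: int) ^ 0" by (simp add: power_neg3)
    hence "r = 0" by (rule power_neg3_inject)
    thus ?thesis using 3 s by simp
  next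
    case 4
    have big: "2 * int q + 2 \<le> 2 ^ q"
      using 4 by (induction q rule: dec_induct) auto
    define e where "e = s - r - 1"
    have s: "s = r + 1 + e" and e: "e \<ge> Suc q" using one big by (auto simp: e_def)
    have "3 * 3 ^ q + (- 1) ^ q - 4 * 2 ^ q = 3 * (- 3) ^ r * (3 ^ e - (- 1 :: int) ^ e)"
      using two one unfolding s by (simp add: power_add algebra_simps flip: power_neg3(1))
    hence "\<bar>3 * 3 ^ q + (- 1) ^ q - 4 * 2 ^ q\<bar> = 3 * 3 ^ r * \<bar>3 ^ e - (- 1 :: int) ^ e\<bar>"
      by (simp add: abs_mult power_abs)
    also have "\<dots> \<ge> 3 * 1 * (3 ^ Suc q - 1)"
    proof (intro mult_mono)
      have "(3 :: int) ^ Suc q \<le> 3 ^ e" using e by (intro power_increasing) auto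
      moreover have "(- 1 :: int) ^ e \<le> 1" by (cases "even e") auto
      ultimately show "3 ^ Suc q - 1 \<le> \<bar>3 ^ e - (- 1 :: int) ^ e\<bar>" by linarith
    qed auto
    finally have lower: "3 * (3 * 3 ^ q - 1) \<le> \<bar>3 * 3 ^ q + (- 1) ^ q - 4 * (2 :: int) ^ q\<bar>" by simp
    have bounds: "(2 :: int) ^ q \<le> 3 ^ q" by (intro power_mono) auto
    have "(- 1 :: int) ^ q \<le> 1" "(- 1 :: int) ^ q \<ge> - 1" by (cases "even q"; simp)+
    moreover have "(3 :: int) ^ q \<ge> 27" using power_increasing[OF 4, of "3 :: int"] by simp
    moreover have "(2 :: int) ^ q \<ge> 0" by simp
    moreover have "\<bar>3 * X + Z - 4 * Y\<bar> < 3 * (3 * X - 1)"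
      if "Z \<le> 1" "- 1 \<le> Z" "27 \<le> X" "0 \<le> Y" "Y \<le> X" for X Y Z :: int
      using that by presburger
    ultimately have "\<bar>3 * 3 ^ q + (- 1) ^ q - 4 * (2 :: int) ^ q\<bar> < 3 * (3 * 3 ^ q - 1)"
      using bounds by blast
    thus ?thesis using lower by linarith
  qed (use one in auto)
qed

text \<open>
  Of the two parameters 2 and 1, the latter makes every term with a factor \<open>1 - y ^ 2\<close> vanish. For
  positive \<open>q\<close> and \<open>r\<close>, what remains compares \<open>(-3) ^ q\<close> with \<open>(-3) ^ r\<close>.
\<close>

lemma arc_sum_balanced:
  assumes "arc_sum (Suc q) q r (Suc r) 2 1 + arc_sum (Suc q) q r (Suc r) (- 2) (- 1) =
         arc_sum (Suc q) q r (Suc r) 1 2 + arc_sum (Suc q) q r (Suc r) (- 1) (- 2)"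
  shows "q = r"
proof (cases "q = 0 \<or> r = 0")
  case False
  hence "(- 3) ^ q = (- 3 :: int) ^ r"
    using assms by (simp add: arc_sum_def power_0_left algebra_simps power_neg3)
  thus ?thesis by (rule power_neg3_inject)
next
  case True
  thus ?thesis
    using assms by (auto simp: arc_sum_def power_0_left algebra_simps power_neg3 split: if_splits)
qed

lemma arc_sum_unbalanced:
  assumes "arc_sum 0 1 r (Suc r) 2 1 + arc_sum 0 1 r (Suc r) (- 2) (- 1) =
         arc_sum 0 1 r (Suc r) 1 2 + arc_sum 0 1 r (Suc r) (- 1) (- 2)"
  shows "r = 0"
  using assms by (simp add: arc_sum_def power_0_left algebra_simps power_neg3 split: if_splits)

section \<open>Converse invariant double stars\<close>

text \<open>
  A star whose centre has equal in- and out-degree is isomorphic to its converse. As a double star,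
  the converse has its central arc at another leaf: \<open>u\<close> becomes an ordinary out-leaf of the centre
  \<open>v\<close>, and a former out-leaf \<open>w\<close> takes its place.
\<close>

lemma balanced_star_isomorphic_converse:
  assumes D: "double_star D u v {} {} Iv Ov" and card: "card Ov = Suc (card Iv)"
  shows "D \<cong> converse_digraph D"
proof -
  note D' = D[unfolded double_star_def]
  obtain w where w: "w \<in> Ov" using card by fastforce
  have "double_star (converse_digraph D) w v {} {} (Ov - {w}) (insert u Iv)"
    using D' w unfolding double_star_def by auto
  thus ?thesis
  proof (rule double_star_isomorphic[OF D])
    show "card Iv = card (Ov - {w})" using card w D' by simp
    show "card Ov = card (insert u Iv)" using card D' by simp
  qed simp_all
qed

lemma digraph_F_double_star: "double_star digraph_F Fu Fv {Fx, Fu'} {} {Fy, Fv'} {}"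
  by (auto simp: double_star_def digraph_F_def)

lemma converse_invariant_converse:
  "converse_invariant D \<Longrightarrow> converse_invariant (converse_digraph D)"
  by (simp add: converse_invariant_def)

text \<open>
  The case in which exactly one of \<open>Iu\<close> and \<open>Ov\<close> is empty. Passing to the converse exchanges the
  sizes of these two sets, so it suffices that \<open>Iu\<close> is the empty one.
\<close>

lemma double_star_cases_no_in_leaf_out_leaf:
  assumes D: "double_star D u v Iu Ou Iv Ov" and inv: "converse_invariant D"
    and big: "card Iu + card Ou \<ge> 2 \<or> card Iv + card Ov \<ge> 2"
    and p: "card Iu = 0" and s: "card Ov > 0"
  shows "D \<cong> converse_digraph D \<or> converse_digraph D \<cong> digraph_F"
proof -
  note ids = converse_invariant_double_star[OF D inv, unfolded p]
  have fin: "finite Iu" "finite Ou" using D by (auto simp: double_star_def)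
  consider "card Ou = 0" "card Ov = Suc (card Iv)" | "card Ou = 1" "card Ov = Suc (card Iv)"
    | "card Ou = 2" "card Iv = 0" "card Ov = 2"
    using star_sum_zero_positive[OF ids(1) ids(1) s] by linarith
  thus ?thesis
  proof cases
    case 1
    hence "Iu = {}" "Ou = {}" using p fin by simp_all
    thus ?thesis using balanced_star_isomorphic_converse[of D u v Iv Ov] D 1 by simp
  next
    case 2
    have "card Iv = 0"
      by (rule arc_sum_unbalanced[OF ids(2)[of 2 1, unfolded 2]])
    thus ?thesis using big p 2 by simp
  next
    case 3
    have "converse_digraph D \<cong> digraph_F"
      by (rule double_star_isomorphic[OF double_star_converse[OF D] digraph_F_double_star])
        (use 3 p in simp_all)
    thus ?thesis ..
  qed
qed

lemma double_star_converse_invariant_cases: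
  assumes D: "double_star D u v Iu Ou Iv Ov" and inv: "converse_invariant D"
    and big: "card Iu + card Ou \<ge> 2 \<or> card Iv + card Ov \<ge> 2"
  shows "D \<cong> converse_digraph D \<or> D \<cong> digraph_F \<or> converse_digraph D \<cong> digraph_F"
proof -
  note ids = converse_invariant_double_star[OF D inv]
  note conv = double_star_converse[OF D]
  have self: "D \<cong> converse_digraph D" if "card Iu = card Ov" "card Ou = card Iv"
    by (rule double_star_isomorphic[OF D conv]) (use that in simp_all)
  consider "card Iu > 0" "card Ov > 0" | "card Iu = 0" "card Ov = 0"
    | "card Iu = 0" "card Ov > 0" | "card Iu > 0" "card Ov = 0" by blast
  thus ?thesis
  proof cases
    case 1
    from star_sum_both_positive[OF ids(1) ids(1) 1] show ?thesis
    proof (elim disjE conjE)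
      assume eq: "card Iu = Suc (card Ou)" "card Ov = Suc (card Iv)"
      have "card Ou = card Iv"
        by (rule arc_sum_balanced[OF ids(2)[of 2 1, unfolded eq]])
      thus ?thesis using self eq by simp
    qed (use self in simp)
  next
    case 2
    hence "card Ou = card Iv"
      using star_sum_both_zero[OF ids(1)[of 1, unfolded 2]] big by linarith
    thus ?thesis using self 2 by simp
  next
    case 3
    thus ?thesis using double_star_cases_no_in_leaf_out_leaf[OF D inv big] by blast
  next
    case 4
    have "converse_digraph D \<cong> D \<or> D \<cong> digraph_F"
      using double_star_cases_no_in_leaf_out_leaf[OF conv converse_invariant_converse[OF inv]] big 4
      by (auto simp: add.commute)
    thus ?thesis using digraph_isomorphic_sym by blast
  qed
qed

section \<open>Trees of diameter at most three\<close>

text \<open>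
  If two paths with the same ends start with different edges, then the first vertex after \<open>u\<close> of
  one path that lies on the other closes a cycle; as its first and its last edge have different ends away from
  \<open>u\<close>, it has length at least three.
\<close>

lemma (in pair_sym_digraph) apath_unique:
  assumes acyclic: "\<nexists>c. cycle c \<and> 3 \<le> length c"
  shows "apath u p v \<Longrightarrow> apath u q v \<Longrightarrow> p = q"
proof (induction p arbitrary: u q)
  case Nil
  hence "u = v" by (simp add: apath_Nil_iff)
  thus ?case using apath_nonempty_ends[OF Nil.prems(2)] by auto
next
  case (Cons e p)
  have "u \<noteq> v" using apath_nonempty_ends[OF Cons.prems(1)] by simp
  then obtain f q' where q: "q = f # q'"
    using Cons.prems(2) by (cases q) (auto simp: apath_Nil_iff)
  have e: "e \<in> parcs G" "fst e = u" "apath (snd e) p v" "u \<notin> set (pawalk_verts (snd e) p)"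
    using Cons.prems(1) by (auto simp: apath_Cons_iff)
  have f: "f \<in> parcs G" "fst f = u" "apath (snd f) q' v" "u \<notin> set (pawalk_verts (snd f) q')"
    using Cons.prems(2) q by (auto simp: apath_Cons_iff)
  show ?case
  proof (cases "snd e = snd f")
    case True
    hence "e = f" using e(2) f(2) by (simp add: prod_eq_iff)
    moreover have "p = q'" using Cons.IH[OF e(3)] f(3) True by simp
    ultimately show ?thesis using q by simp
  next
    case False
    have walks: "awalk (snd e) p v" "awalk (snd f) q' v"
      and dist: "distinct (pawalk_verts (snd e) p)" "distinct (pawalk_verts (snd f) q')"
      using e(3) f(3) by (auto simp: apath_def)
    have end_in: "y \<in> set (pawalk_verts x r)" if "awalk x r y" for x r y
      by (metis that awalkE' awalk_verts_non_Nil last_in_set)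
    have "v \<in> set (pawalk_verts (snd e) p)" "v \<in> set (pawalk_verts (snd f) q')"
      using end_in walks by blast+
    then obtain xs w ys where P: "pawalk_verts (snd e) p = xs @ w # ys"
      "w \<in> set (pawalk_verts (snd f) q')" "\<forall>x\<in>set xs. x \<notin> set (pawalk_verts (snd f) q')"
      using split_list_first_prop[of "pawalk_verts (snd e) p" "\<lambda>x. x \<in> set (pawalk_verts (snd f) q')"]
      by blast
    then obtain as bs where Q: "pawalk_verts (snd f) q' = as @ w # bs"
      by (meson split_list)
    obtain p1 p2 where p: "p = p1 @ p2" "pcas (snd e) p1 w" "pawalk_verts (snd e) p1 = xs @ [w]"
      using awalk_decomp_verts[OF _ P(1)] walks(1) by (metis awalkE')
    obtain q1 q2 where q': "q' = q1 @ q2" "pcas (snd f) q1 w" "pawalk_verts (snd f) q1 = as @ [w]"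
      using awalk_decomp_verts[OF _ Q] walks(2) by (metis awalkE')
    have p1: "awalk (snd e) p1 w" and q1: "awalk (snd f) q1 w"
      using walks p q' by (auto simp: awalk_def)
    let ?c = "e # p1 @ rev_path q1 @ [(snd f, u)]"
    have last_arc: "awalk (snd f) [(snd f, u)] u"
      using f by (auto simp: awalk_simps intro: arcs_symmetric in_arcsD1)
    have tail: "awalk w (rev_path q1 @ [(snd f, u)]) u"
      using q1 last_arc by (intro awalk_appendI[of _ _ "snd f"]) auto
    have rest: "awalk (snd e) (p1 @ rev_path q1 @ [(snd f, u)]) u"
      by (rule awalk_appendI[OF p1 tail])
    have closed: "awalk u ?c u"
      unfolding awalk_Cons_iff using e(1,2) rest by blast
    have "pawalk_verts w (rev_path q1 @ [(snd f, u)]) = rev (as @ [w]) @ [u]"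
      using awalk_verts_append[OF tail] awalk_verts_rev_path[OF q1] q'(3) q1 by simp
    hence "tl (pawalk_verts u ?c) = xs @ [w] @ rev as @ [u]"
      using awalk_verts_append[OF rest] p(3) p1 by simp
    moreover have "distinct (xs @ [w] @ rev as @ [u])"
      using dist P Q e(4) f(4) by auto
    ultimately have "cycle ?c"
      using closed unfolding cycle_def by auto
    moreover have "p1 \<noteq> [] \<or> q1 \<noteq> []"
      using p(2) q'(2) False by auto
    hence "3 \<le> length ?c" by (cases p1; cases q1) auto
    ultimately show ?thesis using acyclic by blast
  qed
qed

lemma short_apath_of_diameter:
  assumes G: "pair_wf_digraph G" and diam: "diameter G \<le> ereal (real n)"
    and uv: "u \<in> pverts G" "v \<in> pverts G"
  obtains p where "pre_digraph.apath (with_proj G) u p v" "length p \<le> n"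
proof -
  interpret pair_wf_digraph G by (rule G)
  have "\<mu> (\<lambda>_. 1) u v \<le> diameter G"
    unfolding diameter_def using uv by (meson SUP_upper2 order_refl)
  hence "(INF p\<in>{p. awalk u p v}. ereal (awalk_cost (\<lambda>_. 1) p)) < ereal (real (Suc n))"
    using diam unfolding \<mu>_def by (rule le_less_trans[OF order_trans]) simp
  then obtain p where p: "awalk u p v" "awalk_cost (\<lambda>_. 1) p < real (Suc n)"
    unfolding INF_less_iff by auto
  have "awalk_cost (\<lambda>_. 1) p = real (length p)"
    by (simp add: awalk_cost_def sum_list_triv)
  hence len: "length p \<le> n" using p(2) by simp
  have path: "apath u (awalk_to_apath p) v" by (rule apath_awalk_to_apath[OF p(1)])
  hence "distinct (awalk_to_apath p)"
    by (auto simp: apath_def intro: distinct_verts_imp_distinct)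
  hence "length (awalk_to_apath p) = card (set (awalk_to_apath p))"
    by (simp add: distinct_card)
  also have "\<dots> \<le> card (set p)"
    by (intro card_mono awalk_to_apath_subset[OF p(1)]) simp
  also have "\<dots> \<le> n" using card_length[of p] len by simp
  finally show ?thesis using path that by blast
qed

locale small_tree = pair_graph +
  assumes acyclic: "\<nexists>c. cycle c \<and> 3 \<le> length c"
    and diam: "diameter G \<le> 3"
begin

lemma short_apath:
  assumes "u \<in> pverts G" "v \<in> pverts G"
  obtains p where "apath u p v" "length p \<le> 3"
proof -
  have "diameter G \<le> ereal (real 3)" using diam by simp
  thus ?thesis
    using short_apath_of_diameter[OF pair_wf_digraph, of 3 u v] assms that by blast
qed

lemma closed_set_is_everything:
  assumes S: "u \<in> S" "u \<in> pverts G" and closed: "\<And>a b. a \<in> S \<Longrightarrow> (a, b) \<in> parcs G \<Longrightarrow> b \<in> S"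
    and v: "v \<in> pverts G"
  shows "v \<in> S"
proof -
  have "w \<in> S" if "x \<in> S" "awalk x p w" for x p w
    using that
  proof (induction p arbitrary: x)
    case (Cons e p)
    have "(x, snd e) \<in> parcs G" "awalk (snd e) p w"
      using Cons.prems(2) by (auto simp: awalk_Cons_iff)
    thus ?case using Cons.IH closed[OF Cons.prems(1)] by blast
  qed (simp add: awalk_Nil_iff)
  thus ?thesis
    using short_apath[OF S(2) v] S(1) by (metis awalkI_apath)
qed

lemma no_triangle:
  assumes "(a, b) \<in> parcs G" "(b, c) \<in> parcs G" "(c, a) \<in> parcs G"
  shows False
proof -
  have "a \<noteq> b" "b \<noteq> c" "c \<noteq> a" using assms by (auto dest: no_loops')
  hence "cycle [(a, b), (b, c), (c, a)]"
    using assms unfolding cycle_def by (intro exI[of _ a]) (auto simp: awalk_simps intro: in_arcsD1)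
  thus False using acyclic by force
qed

lemma no_quadrilateral:
  assumes "(a, b) \<in> parcs G" "(b, c) \<in> parcs G" "(c, d) \<in> parcs G" "(d, a) \<in> parcs G"
    and "a \<noteq> c" "b \<noteq> d"
  shows False
proof -
  have "a \<noteq> b" "b \<noteq> c" "c \<noteq> d" "d \<noteq> a" using assms by (auto dest: no_loops')
  hence "cycle [(a, b), (b, c), (c, d), (d, a)]"
    using assms unfolding cycle_def by (intro exI[of _ a]) (auto simp: awalk_simps intro: in_arcsD1)
  thus False using acyclic by force
qed

lemma no_path_of_length_four:
  assumes "(a, b) \<in> parcs G" "(b, c) \<in> parcs G" "(c, d) \<in> parcs G" "(d, e) \<in> parcs G"
    and "distinct [a, b, c, d, e]"
  shows False
proof -
  have path: "apath a [(a, b), (b, c), (c, d), (d, e)] e"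
    using assms by (auto simp: apath_simps intro: in_arcsD2)
  obtain p where p: "apath a p e" "length p \<le> 3"
    using short_apath[of a e] assms by (blast dest: in_arcsD1 in_arcsD2)
  hence "p = [(a, b), (b, c), (c, d), (d, e)]"
    using apath_unique[OF acyclic _ path] by blast
  thus False using p(2) by simp
qed

text \<open>
  A double star has a dominating edge, and an edge \<open>uv\<close> of maximal degree sum is one. Suppose that
  \<open>a\<close> is a neighbour of \<open>u\<close> and has a neighbour \<open>b\<close> other than \<open>u\<close>. Since there is no path with five
  vertices \<open>b\<close>, \<open>a\<close>, \<open>u\<close>, \<open>v\<close>, \<open>y\<close>, the vertex \<open>v\<close> is a leaf while \<open>a\<close> is not,
  so the edge \<open>ua\<close> has a larger degree sum than \<open>uv\<close>.
\<close>

lemma neighbour_of_maximal_edge: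
  assumes uv: "(u, v) \<in> parcs G"
    and max: "\<And>x y. (x, y) \<in> parcs G \<Longrightarrow>
      outdeg (parcs G) x + outdeg (parcs G) y \<le> outdeg (parcs G) u + outdeg (parcs G) v"
    and a: "(u, a) \<in> parcs G" "a \<noteq> v" and b: "(a, b) \<in> parcs G" "b \<noteq> u"
  shows False
proof -
  have sym: "(v, u) \<in> parcs G" "(a, u) \<in> parcs G" "(b, a) \<in> parcs G"
    using uv a b by (auto intro: arcs_symmetric)
  have bv: "b \<noteq> v" "(v, b) \<notin> parcs G"
    using no_triangle[of u a v] no_quadrilateral[of u a b v] uv a b sym
    by (auto dest: arcs_symmetric)
  have "parcs G `` {v} = {u}"
  proof (intro equalityI subsetI)
    fix y assume "y \<in> parcs G `` {v}"
    hence y: "(v, y) \<in> parcs G" by simp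
    show "y \<in> {u}"
    proof (rule ccontr)
      assume "y \<notin> {u}"
      moreover have "y \<noteq> a" using no_triangle[of u v a] uv sym y by auto
      moreover have "y \<noteq> b" using y bv by auto
      moreover have "a \<noteq> b" "u \<noteq> a" "u \<noteq> v" "v \<noteq> y"
        using uv a b y by (auto dest: no_loops')
      ultimately show False
        using no_path_of_length_four[of b a u v y] sym uv y a b bv by auto
    qed
  qed (use sym in auto)
  hence "outdeg (parcs G) v = 1" by (simp add: outdeg_def)
  moreover have "card {u, b} \<le> outdeg (parcs G) a"
    unfolding outdeg_def using sym b pair_finite_arcs by (intro card_mono finite_Image) auto
  ultimately show False using max[OF a(1)] b(2) by simp
qed

lemma dominating_edge:
  assumes "pverts G \<noteq> {}" "\<not> path_graph G"
  obtains u v where "(u, v) \<in> parcs G"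
    "\<And>w. w \<in> pverts G \<Longrightarrow> w = u \<or> w = v \<or> (u, w) \<in> parcs G \<or> (v, w) \<in> parcs G"
proof -
  have "parcs G \<noteq> {}"
  proof
    assume empty: "parcs G = {}"
    obtain x where x: "x \<in> pverts G" using assms(1) by blast
    have "pverts G = {x}"
      using closed_set_is_everything[of x "{x}"] x empty by blast
    hence "path_graph G"
      unfolding path_graph_def using empty by (intro exI[of _ "[x]"]) simp
    thus False using assms(2) by blast
  qed
  let ?f = "\<lambda>(x, y). outdeg (parcs G) x + outdeg (parcs G) y"
  obtain e where e: "e \<in> parcs G" "?f e = Max (?f ` parcs G)"
    using obtains_MAX[OF pair_finite_arcs \<open>parcs G \<noteq> {}\<close>, of ?f] by metis
  obtain u v where e_eq: "e = (u, v)" by (cases e)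
  have uv: "(u, v) \<in> parcs G" "(v, u) \<in> parcs G" using e e_eq by (auto intro: arcs_symmetric)
  have max: "outdeg (parcs G) x + outdeg (parcs G) y \<le> outdeg (parcs G) u + outdeg (parcs G) v"
    if "(x, y) \<in> parcs G" for x y
  proof -
    have "?f (x, y) \<le> Max (?f ` parcs G)"
      using that pair_finite_arcs by (intro Max_ge) auto
    thus ?thesis using e e_eq by simp
  qed
  have max': "outdeg (parcs G) x + outdeg (parcs G) y \<le> outdeg (parcs G) v + outdeg (parcs G) u"
    if "(x, y) \<in> parcs G" for x y
    using max[OF that] by (simp add: add.commute)
  let ?S = "{w. w = u \<or> w = v \<or> (u, w) \<in> parcs G \<or> (v, w) \<in> parcs G}"
  have "w \<in> ?S" if "w \<in> pverts G" for w
  proof (rule closed_set_is_everything[OF _ _ _ that])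
    show "u \<in> ?S" "u \<in> pverts G" using uv by (auto intro: in_arcsD1)
    fix a b assume "a \<in> ?S" "(a, b) \<in> parcs G"
    thus "b \<in> ?S"
      using neighbour_of_maximal_edge[OF uv(1) max, of a b]
        neighbour_of_maximal_edge[OF uv(2) max', of a b] by blast
  qed
  thus ?thesis using uv that by blast
qed

lemma double_star_structure:
  assumes "pverts G \<noteq> {}" "\<not> path_graph G"
  obtains u v Lu Lv where "u \<noteq> v" "finite Lu" "finite Lv" "{u, v} \<inter> (Lu \<union> Lv) = {}" "Lu \<inter> Lv = {}"
    "pverts G = {u, v} \<union> Lu \<union> Lv"
    "parcs G = {(u, v), (v, u)} \<union> (Lu \<times> {u} \<union> {u} \<times> Lu) \<union> (Lv \<times> {v} \<union> {v} \<times> Lv)"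
    "card Lu \<ge> 2 \<or> card Lv \<ge> 2"
proof -
  obtain u v where uv: "(u, v) \<in> parcs G" and dom:
    "\<And>w. w \<in> pverts G \<Longrightarrow> w = u \<or> w = v \<or> (u, w) \<in> parcs G \<or> (v, w) \<in> parcs G"
    using dominating_edge[OF assms] by metis
  define Lu where "Lu = parcs G `` {u} - {v}"
  define Lv where "Lv = parcs G `` {v} - {u}"
  have vu: "(v, u) \<in> parcs G" using uv by (rule arcs_symmetric)
  have neq: "u \<noteq> v" using uv by (rule no_loops')
  have fin: "finite Lu" "finite Lv"
    using pair_finite_arcs by (auto simp: Lu_def Lv_def intro: finite_Image)
  have disj: "{u, v} \<inter> (Lu \<union> Lv) = {}" by (auto simp: Lu_def Lv_def dest: no_loops')
  have disj': "Lu \<inter> Lv = {}"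
    using no_triangle[OF uv] by (auto simp: Lu_def Lv_def dest: arcs_symmetric)
  have V: "pverts G = {u, v} \<union> Lu \<union> Lv"
    using dom uv by (auto simp: Lu_def Lv_def dest: in_arcsD1 in_arcsD2)
  have u: "(u, x) \<in> parcs G" "(x, u) \<in> parcs G" "x \<noteq> v" if "x \<in> Lu" for x
    using that by (auto simp: Lu_def intro: arcs_symmetric)
  have v: "(v, x) \<in> parcs G" "(x, v) \<in> parcs G" "x \<noteq> u" if "x \<in> Lv" for x
    using that by (auto simp: Lv_def intro: arcs_symmetric)
  have no_edge: "(a, b) \<notin> parcs G" if ab: "a \<in> Lu \<union> Lv" "b \<in> Lu \<union> Lv" for a b
  proof
    assume E: "(a, b) \<in> parcs G"
    from ab show False
    proof (elim UnE)
      assume "a \<in> Lu" "b \<in> Lu"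
      thus False using no_triangle[OF u(1) E u(2)] by blast
    next
      assume "a \<in> Lv" "b \<in> Lv"
      thus False using no_triangle[OF v(1) E v(2)] by blast
    next
      assume "a \<in> Lu" "b \<in> Lv"
      thus False using no_quadrilateral[OF u(1) E v(2) vu] u(3) v(3) by metis
    next
      assume "a \<in> Lv" "b \<in> Lu"
      thus False using no_quadrilateral[OF v(1) E u(2) uv] u(3) v(3) by metis
    qed
  qed
  have arcs: "parcs G = {(u, v), (v, u)} \<union> (Lu \<times> {u} \<union> {u} \<times> Lu) \<union> (Lv \<times> {v} \<union> {v} \<times> Lv)"
    (is "_ = ?R")
  proof (intro equalityI subsetI)
    fix e assume "e \<in> parcs G"
    then obtain a b where e: "e = (a, b)" and ab: "(a, b) \<in> parcs G" "(b, a) \<in> parcs G"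
      by (cases e) (auto intro: arcs_symmetric)
    have "a \<in> {u, v} \<union> Lu \<union> Lv" "b \<in> {u, v} \<union> Lu \<union> Lv"
      using ab V by (blast dest: in_arcsD1 in_arcsD2)+
    hence "a \<in> {u, v} \<or> b \<in> {u, v}" using no_edge ab by blast
    moreover have "b = v \<or> b \<in> Lu" if "a = u" using ab that by (auto simp: Lu_def)
    moreover have "b = u \<or> b \<in> Lv" if "a = v" using ab that by (auto simp: Lv_def)
    moreover have "a = v \<or> a \<in> Lu" if "b = u" using ab that by (auto simp: Lu_def)
    moreover have "a = u \<or> a \<in> Lv" if "b = v" using ab that by (auto simp: Lv_def)
    ultimately show "e \<in> ?R" unfolding e by blast
  next
    fix e assume "e \<in> ?R"
    thus "e \<in> parcs G" using uv vu u v by blast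
  qed
  have "card Lu \<ge> 2 \<or> card Lv \<ge> 2"
  proof (rule ccontr)
    assume "\<not> ?thesis"
    hence small: "card Lu \<le> 1" "card Lv \<le> 1" by auto
    have single: "L = {} \<or> (\<exists>x. L = {x})" if "finite L" "card L \<le> 1" for L :: "'a set"
    proof -
      have "card L = 0 \<or> card L = 1" using that(2) by linarith
      thus ?thesis using that(1) by (metis card_0_eq card_1_singletonE)
    qed
    from single[OF fin(1) small(1)] single[OF fin(2) small(2)]
    have "path_graph G"
    proof (elim disjE exE)
      assume "Lu = {}" "Lv = {}"
      thus ?thesis unfolding path_graph_def using V arcs neq
        by (intro exI[of _ "[u, v]"]) auto
    next
      fix y assume "Lu = {}" "Lv = {y}"
      thus ?thesis unfolding path_graph_def using V arcs neq disj
        by (intro exI[of _ "[u, v, y]"]) auto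
    next
      fix x assume "Lu = {x}" "Lv = {}"
      thus ?thesis unfolding path_graph_def using V arcs neq disj
        by (intro exI[of _ "[x, u, v]"]) auto
    next
      fix x y assume "Lu = {x}" "Lv = {y}"
      thus ?thesis unfolding path_graph_def using V arcs neq disj disj'
        by (intro exI[of _ "[x, u, v, y]"]) auto
    qed
    thus False using assms(2) by blast
  qed
  thus ?thesis using that neq fin disj disj' V arcs by blast
qed

end

lemma orientation_double_star:
  assumes D: "orientation D G"
    and G: "u \<noteq> v" "finite Lu" "finite Lv" "{u, v} \<inter> (Lu \<union> Lv) = {}" "Lu \<inter> Lv = {}"
      "pverts G = {u, v} \<union> Lu \<union> Lv"
      "parcs G = {(u, v), (v, u)} \<union> (Lu \<times> {u} \<union> {u} \<times> Lu) \<union> (Lv \<times> {v} \<union> {v} \<times> Lv)"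
    and uv: "(u, v) \<in> parcs D"
  obtains Iu Ou Iv Ov where "double_star D u v Iu Ou Iv Ov"
    "card Iu + card Ou = card Lu" "card Iv + card Ov = card Lv"
proof -
  let ?Iu = "{x \<in> Lu. (x, u) \<in> parcs D}" and ?Ou = "{x \<in> Lu. (u, x) \<in> parcs D}"
  let ?Iv = "{x \<in> Lv. (x, v) \<in> parcs D}" and ?Ov = "{x \<in> Lv. (v, x) \<in> parcs D}"
  have V: "pverts D = pverts G" and sub: "parcs D \<subseteq> parcs G"
    and ex: "\<And>a b. (a, b) \<in> parcs G \<Longrightarrow> (a, b) \<in> parcs D \<longleftrightarrow> (b, a) \<notin> parcs D"
    using D by (auto simp: orientation_def)
  have vu: "(v, u) \<notin> parcs D" using ex[of u v] uv G(7) by simp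
  have exu: "(x, u) \<in> parcs D \<longleftrightarrow> (u, x) \<notin> parcs D" if "x \<in> Lu" for x
    using that G(7) by (intro ex) simp
  have exv: "(x, v) \<in> parcs D \<longleftrightarrow> (v, x) \<notin> parcs D" if "x \<in> Lv" for x
    using that G(7) by (intro ex) simp
  have Lu: "Lu = ?Iu \<union> ?Ou" "?Iu \<inter> ?Ou = {}" using exu by blast+
  have Lv: "Lv = ?Iv \<union> ?Ov" "?Iv \<inter> ?Ov = {}" using exv by blast+
  have "parcs D = {(u, v)} \<union> (?Iu \<times> {u} \<union> {u} \<times> ?Ou) \<union> (?Iv \<times> {v} \<union> {v} \<times> ?Ov)"
    using sub uv vu unfolding G(7) by blast
  hence "double_star D u v ?Iu ?Ou ?Iv ?Ov"
    unfolding double_star_def V G(6) using G(1-5) Lu Lv by auto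
  moreover have "card ?Iu + card ?Ou = card Lu"
    using card_Un_disjoint[of ?Iu ?Ou] Lu G(2) by simp
  moreover have "card ?Iv + card ?Ov = card Lv"
    using card_Un_disjoint[of ?Iv ?Ov] Lv G(3) by simp
  ultimately show ?thesis using that by blast
qed

section \<open>The characterisation\<close>

theorem theorem1p5:
  fixes G D :: "'a pair_pre_digraph"
  assumes "undirected_tree G"
    and "diameter G \<le> 3"
    and "\<not> path_graph G"
    and "orientation D G"
  shows "converse_invariant D \<longleftrightarrow>
    D \<cong> converse_digraph D \<or> D \<cong> digraph_F \<or> converse_digraph D \<cong> digraph_F"
proof
  assume inv: "converse_invariant D"
  interpret pair_graph G using assms(1) by (simp add: undirected_tree_def)
  interpret small_tree G
    using assms(1,2) by unfold_locales (auto simp: undirected_tree_def)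
  have "pverts G \<noteq> {}"
    using assms(1) by (simp add: undirected_tree_def connected_conv)
  from double_star_structure[OF this assms(3)] obtain u v Lu Lv where
    G: "u \<noteq> v" "finite Lu" "finite Lv" "{u, v} \<inter> (Lu \<union> Lv) = {}" "Lu \<inter> Lv = {}"
    "pverts G = {u, v} \<union> Lu \<union> Lv"
    "parcs G = {(u, v), (v, u)} \<union> (Lu \<times> {u} \<union> {u} \<times> Lu) \<union> (Lv \<times> {v} \<union> {v} \<times> Lv)"
    and big: "card Lu \<ge> 2 \<or> card Lv \<ge> 2"
    by blast
  have "(u, v) \<in> parcs D \<or> (v, u) \<in> parcs D"
    using assms(4) G(7) unfolding orientation_def by blast
  thus "D \<cong> converse_digraph D \<or> D \<cong> digraph_F \<or> converse_digraph D \<cong> digraph_F"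
  proof
    assume "(u, v) \<in> parcs D"
    from orientation_double_star[OF assms(4) G this] obtain Iu Ou Iv Ov where
      D: "double_star D u v Iu Ou Iv Ov"
      "card Iu + card Ou = card Lu" "card Iv + card Ov = card Lv" by blast
    show ?thesis
      by (rule double_star_converse_invariant_cases[OF D(1) inv]) (use D big in simp)
  next
    assume vu: "(v, u) \<in> parcs D"
    have "v \<noteq> u" "{v, u} \<inter> (Lv \<union> Lu) = {}" "Lv \<inter> Lu = {}"
      "pverts G = {v, u} \<union> Lv \<union> Lu"
      "parcs G = {(v, u), (u, v)} \<union> (Lv \<times> {v} \<union> {v} \<times> Lv) \<union> (Lu \<times> {u} \<union> {u} \<times> Lu)"
      using G by auto
    from orientation_double_star[OF assms(4) this(1) G(3,2) this(2-) vu] obtain Iu Ou Iv Ov where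
      D: "double_star D v u Iu Ou Iv Ov"
      "card Iu + card Ou = card Lv" "card Iv + card Ov = card Lu" by blast
    show ?thesis
      by (rule double_star_converse_invariant_cases[OF D(1) inv]) (use D big in auto)
  qed
next
  assume cases: "D \<cong> converse_digraph D \<or> D \<cong> digraph_F \<or> converse_digraph D \<cong> digraph_F"
  have F: "num_copies T D = num_copies T (converse_digraph D)"
    if "D \<cong> digraph_F" "tournament T" for D :: "'a pair_pre_digraph" and T :: "nat pair_pre_digraph"
  proof -
    have "converse_digraph D \<cong> converse_digraph digraph_F"
      using that(1) by (simp only: converse_digraph_isomorphic_iff)
    thus ?thesis
      using that F_converse_invariant num_copies_cong by metis
  qed
  show "converse_invariant D"
    unfolding converse_invariant_def
  proof (intro allI impI)
    fix T :: "nat pair_pre_digraph" assume T: "tournament T"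
    from cases show "num_copies T D = num_copies T (converse_digraph D)"
    proof (elim disjE)
      assume "D \<cong> converse_digraph D"
      thus ?thesis by (rule num_copies_cong)
    next
      assume "D \<cong> digraph_F"
      thus ?thesis using F T by blast
    next
      assume "converse_digraph D \<cong> digraph_F"
      thus ?thesis using F[OF _ T, of "converse_digraph D"] by simp
    qed
  qed
qed

end
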